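(* If $m$ and $n$ are numerals whose values satisfy $m<n$, then $\vdash m<n$.
   Context: $\texttt{set.mm}$ is the Metamath database formalizing mathematics in ZFC set theory. Its terms include the constants $0$ and $1$, the operations $+$ and $\cdot$, the relation $<$, and the defined constants $2:=1+1$, $3:=2+1$, $4:=3+1$, $\dots$, $10:=9+1$; every term is interpreted by its usual value. $\vdash\varphi$ means $\varphi$ is provable in this formal system. A numeral is a term defined recursively by: the terms $0,1,2,3$ are numerals; if $n$ is a numeral with nonzero value and $a\in\{0,1,2,3\}$, then the term $(4\cdot n)+a$ is a numeral. *)

theory Defs
  imports Main
begin

section \<open>Metamath formal systems\<close>

text \<open>
  Abstract Metamath, following the set-theoretic specification in the appendix of the Metamath
  book. An expression is a sequence of symbols, a symbol being a constant or a variable. A frame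
  consists of distinct-variable conditions (unordered pairs of distinct variables),
  variable-type hypotheses (a pair \<open>(c, v)\<close> stands for the expression \<open>c v\<close>),
  logical hypotheses and an assertion. A formal system is given by the set of its axiomatic
  frames (its \<open>$a\<close> statements); formation rules are axiomatic frames too, with a typecode
  such as \<open>wff\<close> in place of the provability sign \<open>|-\<close>.
\<close>

datatype symbol = Cn string | Vr string

type_synonym expression = "symbol list"

datatype frame =
  Frame (frame_dv: "string set set") (frame_types: "(string \<times> string) set")
        (frame_hyps: "expression set") (frame_concl: expression)

definition vars :: "expression \<Rightarrow> string set" where
  "vars e = {v. Vr v \<in> set e}"

fun subst_symbol :: "(string \<Rightarrow> expression) \<Rightarrow> symbol \<Rightarrow> expression" where
  "subst_symbol \<sigma> (Cn c) = [Cn c]"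
| "subst_symbol \<sigma> (Vr v) = \<sigma> v"

definition subst :: "(string \<Rightarrow> expression) \<Rightarrow> expression \<Rightarrow> expression" where
  "subst \<sigma> e = concat (map (subst_symbol \<sigma>) e)"

inductive_set closure ::
    "frame set \<Rightarrow> string set set \<Rightarrow> (string \<times> string) set \<Rightarrow> expression set \<Rightarrow> expression set"
  for \<Gamma> D T H
where
  type_hyp: "(c, v) \<in> T \<Longrightarrow> [Cn c, Vr v] \<in> closure \<Gamma> D T H"
| logical_hyp: "e \<in> H \<Longrightarrow> e \<in> closure \<Gamma> D T H"
| axiom_instance:
    "\<lbrakk> Frame D' T' H' A' \<in> \<Gamma>;
       \<And>c v. (c, v) \<in> T' \<Longrightarrow> Cn c # \<sigma> v \<in> closure \<Gamma> D T H;
       \<And>e. e \<in> H' \<Longrightarrow> subst \<sigma> e \<in> closure \<Gamma> D T H;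
       \<And>a b x y. \<lbrakk> {a, b} \<in> D'; x \<in> vars (\<sigma> a); y \<in> vars (\<sigma> b) \<rbrakk> \<Longrightarrow> {x, y} \<in> D \<rbrakk>
     \<Longrightarrow> subst \<sigma> A' \<in> closure \<Gamma> D T H"

definition frame_vars :: "expression set \<Rightarrow> expression \<Rightarrow> string set" where
  "frame_vars H A = (\<Union>e\<in>insert A H. vars e)"

text \<open>
  A frame is provable if its assertion can be derived when finitely many further (``dummy'')
  variables, with their types and distinct-variable conditions, are made available; the
  conditions on the mandatory variables must be exactly those of the frame.
\<close>

definition provable :: "frame set \<Rightarrow> frame \<Rightarrow> bool" where
  "provable \<Gamma> F \<longleftrightarrow>
     (\<exists>D T. finite D \<and> (\<forall>d\<in>D. card d = 2)
          \<and> finite T \<and> single_valued (T\<inverse>)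
          \<and> frame_vars (frame_hyps F) (frame_concl F) \<subseteq> snd ` T
          \<and> frame_dv F = {d \<in> D. d \<subseteq> frame_vars (frame_hyps F) (frame_concl F)}
          \<and> frame_types F = {(c, v) \<in> T. v \<in> frame_vars (frame_hyps F) (frame_concl F)}
          \<and> frame_concl F \<in> closure \<Gamma> D T (frame_hyps F))"

text \<open>Provability of a formula without variables and without hypotheses.\<close>

definition proves :: "frame set \<Rightarrow> expression \<Rightarrow> bool" (infix "\<turnstile>" 50) where
  "\<Gamma> \<turnstile> \<phi> \<longleftrightarrow> provable \<Gamma> (Frame {} {} {} (Cn ''|-'' # \<phi>))"


section \<open>Reading set.mm source text\<close>

fun split_blanks :: "string \<Rightarrow> string list" where
  "split_blanks [] = [[]]"
| "split_blanks (c # cs) =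
     (if c = CHR '' '' then [] # split_blanks cs
      else (case split_blanks cs of [] \<Rightarrow> [[c]] | w # ws \<Rightarrow> (c # w) # ws))"

definition tokens :: "string \<Rightarrow> string list" where
  "tokens s = filter (\<lambda>w. w \<noteq> []) (split_blanks s)"

text \<open>
  String literals cannot contain a backslash, so the percent sign is written for it below:
  \<open>/%\<close> is conjunction, \<open>%/\<close> disjunction and \<open>%\<close> set difference.
\<close>

definition unescape :: "string \<Rightarrow> string" where
  "unescape s = map (\<lambda>c. if c = CHR ''%'' then CHR 0x5C else c) s"

definition var_type :: "string \<Rightarrow> string option" where
  "var_type = map_of
     (map (\<lambda>v. (v, ''wff'')) (tokens ''ph ps ch'') @
      map (\<lambda>v. (v, ''setvar'')) (tokens ''x y z w v u t'') @
      map (\<lambda>v. (v, ''class'')) (tokens ''A B C F R''))"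

definition mm :: "string \<Rightarrow> expression" where
  "mm s = map (\<lambda>w. if var_type w = None then Cn w else Vr w) (tokens (unescape s))"

text \<open>
  \<open>axd ds hs a\<close> is the frame of an \<open>$a\<close> statement \<open>a\<close> with \<open>$e\<close> hypotheses \<open>hs\<close>; each
  member of \<open>ds\<close> is the list of variables of one \<open>$d\<close> statement. The variable-type hypotheses
  are those of the variables occurring in \<open>hs\<close> or \<open>a\<close>.
\<close>

definition axd :: "string list \<Rightarrow> string list \<Rightarrow> string \<Rightarrow> frame" where
  "axd ds hs a =
     Frame {{p, q} | p q d. d \<in> set ds \<and> p \<in> set (tokens d) \<and> q \<in> set (tokens d) \<and> p \<noteq> q}
           {(c, v). v \<in> frame_vars (mm ` set hs) (mm a) \<and> var_type v = Some c}
           (mm ` set hs) (mm a)"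

abbreviation ax :: "string \<Rightarrow> frame" where
  "ax a \<equiv> axd [] [] a"


section \<open>The axioms of set.mm\<close>

text \<open>
  The \<open>$a\<close> statements below are those of set.mm for classical first-order logic with equality,
  ZFC and the complex numbers, together with the definitions of the notation used in them. The
  axioms for the complex numbers are \<open>$a\<close> statements of set.mm, restated after its construction
  of the constants \<open>CC\<close>, \<open>RR\<close>, \<open>0\<close>, \<open>1\<close>, \<open>_i\<close>, \<open>+\<close>, \<open><RR\<close>, \<open>x.\<close>; the definitions
  making up that construction are not listed. The whole of set.mm is a formal system extending
  \<open>setmm_core\<close>, so a statement about every \<open>\<Gamma>\<close> with \<open>setmm_core \<subseteq> \<Gamma>\<close> covers it.
  The text follows the releases in which \<open>10\<close> is a constant defined as \<open>( 9 + 1 )\<close>. Comments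
  give the set.mm labels, in order, of the statements up to the next comment other than
  formation rules.
\<close>

definition propositional_part :: "frame list" where
  \<open>propositional_part =
   [ax ''wff -. ph'',
    ax ''wff ( ph -> ps )'',
    \<comment> \<open>ax-mp, ax-1, ax-2, ax-3\<close>
    axd [] [''|- ph'', ''|- ( ph -> ps )''] ''|- ps'',
    ax ''|- ( ph -> ( ps -> ph ) )'',
    ax ''|- ( ( ph -> ( ps -> ch ) ) -> ( ( ph -> ps ) -> ( ph -> ch ) ) )'',
    ax ''|- ( ( -. ph -> -. ps ) -> ( ps -> ph ) )'',
    \<comment> \<open>df-bi, df-or, df-an, df-3an\<close>
    ax ''wff ( ph <-> ps )'',
    ax ''|- -. ( ( ( ph <-> ps ) -> -. ( ( ph -> ps ) -> -. ( ps -> ph ) ) ) -> -. ( -. ( ( ph -> ps ) -> -. ( ps -> ph ) ) -> ( ph <-> ps ) ) )'',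
    ax ''wff ( ph %/ ps )'',
    ax ''|- ( ( ph %/ ps ) <-> ( -. ph -> ps ) )'',
    ax ''wff ( ph /% ps )'',
    ax ''|- ( ( ph /% ps ) <-> -. ( ph -> -. ps ) )'',
    ax ''wff ( ph /% ps /% ch )'',
    ax ''|- ( ( ph /% ps /% ch ) <-> ( ( ph /% ps ) /% ch ) )'']\<close>

definition predicate_part :: "frame list" where
  \<open>predicate_part =
   [ax ''wff A. x ph'',
    ax ''class x'',
    ax ''wff A = B'',
    ax ''wff A e. B'',
    \<comment> \<open>df-ex, df-sb\<close>
    ax ''wff E. x ph'',
    ax ''|- ( E. x ph <-> -. A. x -. ph )'',
    ax ''wff [ y / x ] ph'',
    ax ''|- ( [ y / x ] ph <-> ( ( x = y -> ph ) /% E. x ( x = y /% ph ) ) )'',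
    \<comment> \<open>ax-gen, ax-4 to ax-13\<close>
    axd [] [''|- ph''] ''|- A. x ph'',
    ax ''|- ( A. x ( ph -> ps ) -> ( A. x ph -> A. x ps ) )'',
    axd [''x ph''] [] ''|- ( ph -> A. x ph )'',
    ax ''|- -. A. x -. x = y'',
    ax ''|- ( x = y -> ( x = z -> y = z ) )'',
    ax ''|- ( x = y -> ( x e. z -> y e. z ) )'',
    ax ''|- ( x = y -> ( z e. x -> z e. y ) )'',
    ax ''|- ( -. A. x ph -> A. x -. A. x ph )'',
    ax ''|- ( A. x A. y ph -> A. y A. x ph )'',
    ax ''|- ( x = y -> ( A. y ph -> A. x ( x = y -> ph ) ) )'',
    ax ''|- ( -. x = y -> ( y = z -> A. x y = z ) )'']\<close>

definition zfc_part :: "frame list" where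
  \<open>zfc_part =
   [ \<comment> \<open>ax-ext, ax-rep, ax-pow, ax-un, ax-reg, ax-inf, ax-ac\<close>
    axd [''x z'', ''y z''] [] ''|- ( A. z ( z e. x <-> z e. y ) -> x = y )'',
    axd [''x y z w''] []
      ''|- ( A. w E. y A. z ( A. y ph -> z = y ) -> E. y A. z ( z e. y <-> E. w ( w e. x /% A. y ph ) ) )'',
    axd [''x y z w''] [] ''|- E. y A. z ( A. w ( w e. z -> w e. x ) -> z e. y )'',
    axd [''x y z w''] [] ''|- E. y A. z ( E. w ( z e. w /% w e. x ) -> z e. y )'',
    axd [''x y z''] []
      ''|- ( E. y y e. x -> E. y ( y e. x /% A. z ( z e. y -> -. z e. x ) ) )'',
    axd [''x y z w''] []
      ''|- E. y ( x e. y /% A. z ( z e. y -> E. w ( z e. w /% w e. y ) ) )'',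
    axd [''x y z w v u t''] []
      ''|- E. y A. z A. w ( ( z e. w /% w e. x ) -> E. v A. u ( E. t ( ( u e. w /% w e. t ) /% ( u e. t /% t e. y ) ) <-> u = v ) )'',
    \<comment> \<open>ax-sep, ax-nul, ax-pr\<close>
    axd [''x y z'', ''y ph''] [] ''|- E. y A. x ( x e. y <-> ( x e. z /% ph ) )'',
    axd [''x y''] [] ''|- E. x A. y -. y e. x'',
    axd [''x z w'', ''y z w''] [] ''|- E. z A. w ( ( w = x %/ w = y ) -> w e. z )'']\<close>

definition class_part :: "frame list" where
  \<open>class_part =
   [ \<comment> \<open>df-clab, df-cleq, df-clel\<close>
    ax ''class { x | ph }'',
    ax ''|- ( x e. { y | ph } <-> [ x / y ] ph )'',
    axd [''x y z'', ''x A'', ''x B''] [''|- ( A. x ( x e. y <-> x e. z ) -> y = z )'']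
      ''|- ( A = B <-> A. x ( x e. A <-> x e. B ) )'',
    axd [''x A'', ''x B''] [] ''|- ( A e. B <-> E. x ( x = A /% x e. B ) )'',
    \<comment> \<open>df-ne, df-ral, df-rex, df-v\<close>
    ax ''wff A =/= B'',
    ax ''|- ( A =/= B <-> -. A = B )'',
    ax ''wff A. x e. A ph'',
    ax ''|- ( A. x e. A ph <-> A. x ( x e. A -> ph ) )'',
    ax ''wff E. x e. A ph'',
    ax ''|- ( E. x e. A ph <-> E. x ( x e. A /% ph ) )'',
    ax ''class _V'',
    ax ''|- _V = { x | x = x }'',
    \<comment> \<open>df-dif, df-un, df-in, df-ss, df-nul\<close>
    ax ''class ( A % B )'',
    axd [''x A'', ''x B''] [] ''|- ( A % B ) = { x | ( x e. A /% -. x e. B ) }'',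
    ax ''class ( A u. B )'',
    axd [''x A'', ''x B''] [] ''|- ( A u. B ) = { x | ( x e. A %/ x e. B ) }'',
    ax ''class ( A i^i B )'',
    axd [''x A'', ''x B''] [] ''|- ( A i^i B ) = { x | ( x e. A /% x e. B ) }'',
    ax ''wff A C_ B'',
    ax ''|- ( A C_ B <-> ( A i^i B ) = A )'',
    ax ''class (/)'',
    ax ''|- (/) = ( _V % _V )'',
    \<comment> \<open>df-pw, df-sn, df-pr, df-op, df-uni\<close>
    ax ''class ~P A'',
    axd [''x A''] [] ''|- ~P A = { x | x C_ A }'',
    ax ''class { A }'',
    axd [''x A''] [] ''|- { A } = { x | x = A }'',
    ax ''class { A , B }'',
    ax ''|- { A , B } = ( { A } u. { B } )'',
    ax ''class <. A , B >.'',
    axd [''x A'', ''x B''] []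
      ''|- <. A , B >. = { x | ( A e. _V /% B e. _V /% x e. { { A } , { A , B } } ) }'',
    ax ''class U. A'',
    axd [''x y A''] [] ''|- U. A = { x | E. y ( x e. y /% y e. A ) }'',
    \<comment> \<open>df-br, df-opab, df-xp\<close>
    ax ''wff A R B'',
    ax ''|- ( A R B <-> <. A , B >. e. R )'',
    ax ''class { <. x , y >. | ph }'',
    axd [''x z'', ''y z'', ''z ph''] []
      ''|- { <. x , y >. | ph } = { z | E. x E. y ( z = <. x , y >. /% ph ) }'',
    ax ''class ( A X. B )'',
    axd [''x y A'', ''x y B''] [] ''|- ( A X. B ) = { <. x , y >. | ( x e. A /% y e. B ) }'',
    \<comment> \<open>df-iota, df-fv, df-ov\<close>
    ax ''class ( iota x ph )'',
    axd [''x y'', ''y ph''] [] ''|- ( iota x ph ) = U. { y | { x | ph } = { y } }'',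
    ax ''class ( F ` A )'',
    axd [''x A'', ''x F''] [] ''|- ( F ` A ) = ( iota x A F x )'',
    ax ''class ( A F B )'',
    ax ''|- ( A F B ) = ( F ` <. A , B >. )'']\<close>

definition complex_part :: "frame list" where
  \<open>complex_part =
   [ax ''class CC'', ax ''class RR'', ax ''class 0'', ax ''class 1'', ax ''class _i'',
    ax ''class +'', ax ''class <RR'', ax ''class x.'',
    \<comment> \<open>ax-cnex, ax-resscn, ax-1cn, ax-icn\<close>
    ax ''|- CC e. _V'',
    ax ''|- RR C_ CC'',
    ax ''|- 1 e. CC'',
    ax ''|- _i e. CC'',
    \<comment> \<open>ax-addcl, ax-addrcl, ax-mulcl, ax-mulrcl\<close>
    ax ''|- ( ( A e. CC /% B e. CC ) -> ( A + B ) e. CC )'',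
    ax ''|- ( ( A e. RR /% B e. RR ) -> ( A + B ) e. RR )'',
    ax ''|- ( ( A e. CC /% B e. CC ) -> ( A x. B ) e. CC )'',
    ax ''|- ( ( A e. RR /% B e. RR ) -> ( A x. B ) e. RR )'',
    \<comment> \<open>ax-mulcom, ax-addass, ax-mulass, ax-distr\<close>
    ax ''|- ( ( A e. CC /% B e. CC ) -> ( A x. B ) = ( B x. A ) )'',
    ax ''|- ( ( A e. CC /% B e. CC /% C e. CC ) -> ( ( A + B ) + C ) = ( A + ( B + C ) ) )'',
    ax ''|- ( ( A e. CC /% B e. CC /% C e. CC ) -> ( ( A x. B ) x. C ) = ( A x. ( B x. C ) ) )'',
    ax ''|- ( ( A e. CC /% B e. CC /% C e. CC ) -> ( A x. ( B + C ) ) = ( ( A x. B ) + ( A x. C ) ) )'',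
    \<comment> \<open>ax-i2m1, ax-1ne0, ax-1rid, ax-rnegex, ax-rrecex, ax-cnre\<close>
    ax ''|- ( ( _i x. _i ) + 1 ) = 0'',
    ax ''|- 1 =/= 0'',
    ax ''|- ( A e. RR -> ( A x. 1 ) = A )'',
    axd [''x A''] [] ''|- ( A e. RR -> E. x e. RR ( A + x ) = 0 )'',
    axd [''x A''] [] ''|- ( ( A e. RR /% A =/= 0 ) -> E. x e. RR ( A x. x ) = 1 )'',
    axd [''x y A''] [] ''|- ( A e. CC -> E. x e. RR E. y e. RR A = ( x + ( _i x. y ) ) )'',
    \<comment> \<open>ax-pre-lttri, ax-pre-lttrn, ax-pre-ltadd, ax-pre-mulgt0, ax-pre-sup\<close>
    ax ''|- ( ( A e. RR /% B e. RR ) -> ( A <RR B <-> -. ( A = B %/ B <RR A ) ) )'',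
    ax ''|- ( ( A e. RR /% B e. RR /% C e. RR ) -> ( ( A <RR B /% B <RR C ) -> A <RR C ) )'',
    ax ''|- ( ( A e. RR /% B e. RR /% C e. RR ) -> ( A <RR B -> ( C + A ) <RR ( C + B ) ) )'',
    ax ''|- ( ( A e. RR /% B e. RR ) -> ( ( 0 <RR A /% 0 <RR B ) -> 0 <RR ( A x. B ) ) )'',
    axd [''x y z A''] []
      ''|- ( ( A C_ RR /% A =/= (/) /% E. x e. RR A. y e. A y <RR x ) -> E. x e. RR ( A. y e. A -. x <RR y /% A. y e. RR ( y <RR x -> E. z e. A y <RR z ) ) )'',
    \<comment> \<open>df-pnf, df-mnf, df-ltxr\<close>
    ax ''class +oo'',
    ax ''|- +oo = ~P U. CC'',
    ax ''class -oo'',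
    ax ''|- -oo = ~P +oo'',
    ax ''class <'',
    axd [''x y''] []
      ''|- < = ( { <. x , y >. | ( x e. RR /% y e. RR /% x <RR y ) } u. ( ( ( RR u. { -oo } ) X. { +oo } ) u. ( { -oo } X. RR ) ) )'',
    \<comment> \<open>df-2 to df-10\<close>
    ax ''class 2'', ax ''|- 2 = ( 1 + 1 )'',
    ax ''class 3'', ax ''|- 3 = ( 2 + 1 )'',
    ax ''class 4'', ax ''|- 4 = ( 3 + 1 )'',
    ax ''class 5'', ax ''|- 5 = ( 4 + 1 )'',
    ax ''class 6'', ax ''|- 6 = ( 5 + 1 )'',
    ax ''class 7'', ax ''|- 7 = ( 6 + 1 )'',
    ax ''class 8'', ax ''|- 8 = ( 7 + 1 )'',
    ax ''class 9'', ax ''|- 9 = ( 8 + 1 )'',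
    ax ''class 10'', ax ''|- 10 = ( 9 + 1 )'']\<close>

definition setmm_core :: "frame set" where
  "setmm_core = set (propositional_part @ predicate_part @ zfc_part @ class_part @ complex_part)"


section \<open>Arithmetic terms and numerals\<close>

datatype arith_term =
    Zero | One | Two | Three | Four | Five | Six | Seven | Eight | Nine | Ten
  | Plus arith_term arith_term
  | Times arith_term arith_term

fun term_expr :: "arith_term \<Rightarrow> expression" where
  "term_expr Zero = [Cn ''0'']"
| "term_expr One = [Cn ''1'']"
| "term_expr Two = [Cn ''2'']"
| "term_expr Three = [Cn ''3'']"
| "term_expr Four = [Cn ''4'']"
| "term_expr Five = [Cn ''5'']"
| "term_expr Six = [Cn ''6'']"
| "term_expr Seven = [Cn ''7'']"
| "term_expr Eight = [Cn ''8'']"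
| "term_expr Nine = [Cn ''9'']"
| "term_expr Ten = [Cn ''10'']"
| "term_expr (Plus s t) = [Cn ''(''] @ term_expr s @ [Cn ''+''] @ term_expr t @ [Cn '')'']"
| "term_expr (Times s t) = [Cn ''(''] @ term_expr s @ [Cn ''x.''] @ term_expr t @ [Cn '')'']"

fun term_value :: "arith_term \<Rightarrow> nat" where
  "term_value Zero = 0"
| "term_value One = 1"
| "term_value Two = 2"
| "term_value Three = 3"
| "term_value Four = 4"
| "term_value Five = 5"
| "term_value Six = 6"
| "term_value Seven = 7"
| "term_value Eight = 8"
| "term_value Nine = 9"
| "term_value Ten = 10"
| "term_value (Plus s t) = term_value s + term_value t"
| "term_value (Times s t) = term_value s * term_value t"

inductive numeral_term :: "arith_term \<Rightarrow> bool" where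
  digit: "a \<in> {Zero, One, Two, Three} \<Longrightarrow> numeral_term a"
| step: "\<lbrakk> numeral_term n; term_value n \<noteq> 0; a \<in> {Zero, One, Two, Three} \<rbrakk>
         \<Longrightarrow> numeral_term (Plus (Times Four n) a)"

text \<open>In set.mm a binary relation is written infix without parentheses.\<close>

definition less_wff :: "arith_term \<Rightarrow> arith_term \<Rightarrow> expression" where
  "less_wff s t = term_expr s @ [Cn ''<''] @ term_expr t"

end

theory Submission
  imports Defs
begin

text \<open>
  By a Lindenbaum argument a formula is provable as soon as it lies in every maximal consistent
  set, so propositional and equational reasoning takes place inside such a set; Hilbert-style
  derivations are needed only for the quantifiers. There the class terms modulo provable equality
  satisfy the axioms of arithmetic, except that the existential axioms have to be used one witness
  at a time.

  Commutativity of addition is not an axiom, but left cancellation of reals follows from the order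
  axioms, so an additive idempotent is a left identity. A nonzero real idempotent would, multiplied
  by its reciprocal, make \<open>1\<close> idempotent, and then \<open>0 = (i * i + 1) + 1 = 0 + 1 = 1\<close>. Hence
  \<open>0\<close> is the only idempotent, which gives \<open>0 + a = a\<close>, \<open>1 + 0 = 1\<close> and \<open>0 < 1\<close>; a numeral then
  equals a sum of ones by associativity and distributivity alone.
\<close>

section \<open>Derivations with infinitely many variables\<close>

text \<open>A maximal consistent set decides the connectives only: it may contain
  \<open>Ex x p\<close> without any instance of \<open>p\<close>, so no additive inverse or
  reciprocal need exist inside it. The remedy is to prove \<open>p --> q\<close> in all models, with
  the witness as a variable that does not occur in \<open>q\<close>, and to discharge that variable
  at the level of theorems. Hence the alternation between the two levels: each fact about
  \<open>0\<close> and \<open>1\<close> that needs a witness (both are real,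
  \<open>0 + 0 = 0\<close>, \<open>1 + 0 = 1\<close>, \<open>0 < 1\<close>) becomes a theorem of its
  own before the next model argument can use it. No axiom says that \<open>0\<close> or
  \<open>1\<close> is real, so even this starts from existential axioms. Congruence of
  \<open>+\<close> and \<open>x.\<close> is not an axiom either: \<open>A + B\<close> is the value
  of a class at an ordered pair, and equality has to be carried through the definitions of pair,
  union, iota and function value. Finally, the axioms speak of \<open><RR\<close>, while the theorem
  speaks of \<open><\<close> on the extended reals, a union whose first member is \<open><RR\<close>
  restricted to pairs of reals.\<close>

lemma closure_mono:
  assumes "\<Gamma> \<subseteq> \<Gamma>'" "D \<subseteq> D'" "T \<subseteq> T'" "H \<subseteq> H'"
  shows "closure \<Gamma> D T H \<subseteq> closure \<Gamma>' D' T' H'"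
proof
  fix e assume "e \<in> closure \<Gamma> D T H"
  then show "e \<in> closure \<Gamma>' D' T' H'"
  proof induction
    case (axiom_instance D1 T1 H1 A1 \<sigma>)
    show ?case
    proof (rule closure.axiom_instance)
      show "Frame D1 T1 H1 A1 \<in> \<Gamma>'" using axiom_instance.hyps(1) assms(1) by blast
      show "{x, y} \<in> D'" if "{a, b} \<in> D1" "x \<in> vars (\<sigma> a)" "y \<in> vars (\<sigma> b)" for a b x y
        using axiom_instance.hyps(4)[OF that] assms(2) by blast
    qed (fact axiom_instance.IH)+
  qed (use assms in \<open>auto intro: closure.intros\<close>)
qed

lemma finite_vars [simp]: "finite (vars e)"
proof -
  have "vars e = Vr -` set e" by (auto simp: vars_def)
  then show ?thesis by (auto intro: finite_vimageI simp: inj_on_def)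
qed

text \<open>\<open>closure\<close> would allow a frame with infinitely many hypotheses, whose
  instances could bring together infinitely many variables. The parsed statements are finite text;
  \<open>\<Union>D\<close> collects the variables under a distinctness condition.\<close>

lemma finite_axd:
  assumes "axd ds hs a = Frame D T H A"
  shows "finite T" and "finite H" and "finite (\<Union>D)"
proof -
  define V where "V = frame_vars (mm ` set hs) (mm a)"
  have eqs: "D = {{p, q} | p q d. d \<in> set ds \<and> p \<in> set (tokens d) \<and> q \<in> set (tokens d) \<and> p \<noteq> q}"
    "T = {(c, v). v \<in> V \<and> var_type v = Some c}" "H = mm ` set hs"
    using assms unfolding axd_def V_def frame.inject by - (elim conjE, rule sym, assumption)+
  have "finite V" by (simp add: V_def frame_vars_def)
  moreover have "T \<subseteq> (\<lambda>v. (the (var_type v), v)) ` V"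
    unfolding eqs by force
  ultimately show "finite T" by (meson finite_imageI finite_subset)
  show "finite H" by (simp add: eqs)
  have "\<Union>D \<subseteq> (\<Union>d\<in>set ds. set (tokens d))"
    unfolding eqs by blast
  then show "finite (\<Union>D)" by (rule finite_subset) simp
qed

lemma setmm_core_axd:
  assumes "F \<in> setmm_core"
  shows "\<exists>ds hs a. F = axd ds hs a"
proof -
  have mem: "axd ds hs a \<in> {F. \<exists>ds hs a. F = axd ds hs a}" for ds hs a by blast
  have "setmm_core \<subseteq> {F. \<exists>ds hs a. F = axd ds hs a}"
    unfolding setmm_core_def propositional_part_def predicate_part_def zfc_part_def
      class_part_def complex_part_def
    by (simp only: set_append list.set Un_subset_iff insert_subset empty_subsetI mem simp_thms)
  then show ?thesis using assms by blast
qed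

text \<open>Derivations are carried out with all strings as set variables, so that fresh variables
  always exist; only finitely many of them matter for one derivation.\<close>

definition pairs :: "string set \<Rightarrow> string set set" where
  "pairs V = {{x, y} | x y. x \<in> V \<and> y \<in> V \<and> x \<noteq> y}"

lemma pairs_iff: "{x, y} \<in> pairs V \<longleftrightarrow> x \<in> V \<and> y \<in> V \<and> x \<noteq> y"
  by (auto simp: pairs_def doubleton_eq_iff)

definition setvars :: "string set \<Rightarrow> (string \<times> string) set" where
  "setvars V = {''setvar''} \<times> V"

abbreviation Cl :: "string set \<Rightarrow> expression set" where
  "Cl V \<equiv> closure setmm_core (pairs V) (setvars V) {}"

lemma Cl_mono: "V \<subseteq> W \<Longrightarrow> Cl V \<subseteq> Cl W"
  by (rule closure_mono) (auto simp: pairs_def setvars_def)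

text \<open>Compactness: an instance has finitely many premises, so the finite variable sets used
  for them can be united.\<close>

lemma Cl_finite:
  assumes "e \<in> Cl UNIV"
  shows "\<exists>V. finite V \<and> e \<in> Cl V"
  using assms
proof induction
  case (type_hyp c v)
  then show ?case
    by (intro exI[of _ "{v}"]) (auto simp: setvars_def intro: closure.type_hyp)
next
  case (axiom_instance D T H A \<sigma>)
  obtain ds hs a where "axd ds hs a = Frame D T H A"
    using setmm_core_axd[OF axiom_instance.hyps(1)] by metis
  note fin = finite_axd[OF this]
  have "\<forall>p. \<exists>V. p \<in> T \<longrightarrow> finite V \<and> Cn (fst p) # \<sigma> (snd p) \<in> Cl V"
    using axiom_instance.IH(1) by (metis prod.collapse)
  then obtain f where f: "\<And>p. p \<in> T \<Longrightarrow> finite (f p) \<and> Cn (fst p) # \<sigma> (snd p) \<in> Cl (f p)"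
    by metis
  have "\<forall>e. \<exists>V. e \<in> H \<longrightarrow> finite V \<and> subst \<sigma> e \<in> Cl V"
    using axiom_instance.IH(2) by metis
  then obtain g where g: "\<And>e. e \<in> H \<Longrightarrow> finite (g e) \<and> subst \<sigma> e \<in> Cl (g e)"
    by metis
  \<comment> \<open>The third union serves the distinctness conditions: \<open>pairs W\<close> must
    contain the pair of any two variables substituted under a condition, whether or not the sets
    chosen for the premises contain them.\<close>
  define W where "W = (\<Union>p\<in>T. f p) \<union> (\<Union>e\<in>H. g e) \<union> (\<Union>a\<in>\<Union>D. vars (\<sigma> a))"
  have "subst \<sigma> A \<in> Cl W"
  proof (rule closure.axiom_instance[OF axiom_instance.hyps(1)])
    fix c v assume cv: "(c, v) \<in> T"
    then have "f (c, v) \<subseteq> W" unfolding W_def by blast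
    then show "Cn c # \<sigma> v \<in> Cl W" using f[OF cv] Cl_mono by auto
  next
    fix e assume e: "e \<in> H"
    then have "g e \<subseteq> W" unfolding W_def by blast
    then show "subst \<sigma> e \<in> Cl W" using g[OF e] Cl_mono by auto
  next
    fix a b x y
    assume ab: "{a, b} \<in> D" and xy: "x \<in> vars (\<sigma> a)" "y \<in> vars (\<sigma> b)"
    then have "x \<noteq> y" using axiom_instance.hyps(4)[OF ab xy] unfolding pairs_iff by simp
    moreover have "a \<in> \<Union>D" "b \<in> \<Union>D" using ab by blast+
    then have "x \<in> W" "y \<in> W" using xy unfolding W_def by blast+
    ultimately show "{x, y} \<in> pairs W" unfolding pairs_iff by blast
  qed
  moreover have "finite W"
    unfolding W_def by (intro finite_UnI finite_UN_I fin finite_vars) (use f g in auto)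
  ultimately show ?case by blast
qed simp

text \<open>Without variables in \<open>\<phi>\<close> every variable of the derivation is a dummy:
  the restrictions of \<open>pairs V\<close> and \<open>setvars V\<close> to the mandatory variables
  are empty, as the frame demands.\<close>

lemma proves_if_Cl:
  assumes "Cn ''|-'' # \<phi> \<in> Cl UNIV" and "vars \<phi> = {}" and "setmm_core \<subseteq> \<Gamma>"
  shows "\<Gamma> \<turnstile> \<phi>"
proof -
  obtain V where V: "finite V" "Cn ''|-'' # \<phi> \<in> Cl V" using Cl_finite assms(1) by blast
  have v: "vars (Cn ''|-'' # \<phi>) = {}" using assms(2) by (auto simp: vars_def)
  have "pairs V \<subseteq> Pow V" by (auto simp: pairs_def)
  then have "finite (pairs V)" using V by (meson finite_Pow_iff finite_subset)
  moreover have "\<forall>d\<in>pairs V. card d = 2" by (auto simp: pairs_def)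
  moreover have "finite (setvars V)" using V by (simp add: setvars_def)
  moreover have "single_valued ((setvars V)\<inverse>)" by (auto simp: setvars_def single_valued_def)
  moreover have "Cn ''|-'' # \<phi> \<in> closure \<Gamma> (pairs V) (setvars V) {}"
    using V closure_mono[OF assms(3) subset_refl subset_refl subset_refl] by blast
  moreover have "frame_vars {} (Cn ''|-'' # \<phi>) = {}" using v by (simp add: frame_vars_def)
  moreover have "{d \<in> pairs V. d \<subseteq> {}} = {}" by (auto simp: pairs_def)
  ultimately show ?thesis
    unfolding proves_def provable_def frame.sel
    by (intro exI[of _ "pairs V"] exI[of _ "setvars V"]) simp
qed

section \<open>Formulas and class terms\<close>

text \<open>One constructor per formation rule that occurs in the schemes below, with
  \<open>Con\<close> for all class constants. \<open>Sb\<close> is a connective governed by df-sb,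
  not an operation on formulas; no substitution on these datatypes is ever defined.\<close>

datatype wf =
    Neg wf ("\<^bold>\<not> _" [40] 40)
  | Imp wf wf (infixr "\<^bold>\<longrightarrow>" 25)
  | Iff wf wf (infixr "\<^bold>\<longleftrightarrow>" 25)
  | Or wf wf (infixr "\<^bold>\<or>" 30)
  | And wf wf (infixr "\<^bold>\<and>" 35)
  | And3 wf wf wf
  | All string wf
  | Ex string wf
  | Sb string string wf
  | Eq cl cl (infix "\<^bold>=" 50)
  | Mem cl cl (infix "\<^bold>\<in>" 50)
  | Ne cl cl
  | Rex string cl wf
  | Ss cl cl
  | Br cl cl cl
and cl =
    Con string
  | SV string
  | Ab string wf
  | Cup cl cl
  | Cap cl cl
  | Sn cl
  | Pr cl cl
  | Op cl cl
  | Uni cl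
  | Opab string string wf
  | Xp cl cl
  | Iota string wf
  | Fv cl cl
  | Ov cl cl cl

definition constants :: "string set" where
  "constants = set (tokens ''_V CC RR 0 1 _i + <RR x. +oo -oo < 2 3 4 5 6 7 8 9 10'')"

text \<open>A name that is not a class constant of the core is read as \<open>0\<close>, so that every
  element of the datatypes denotes a well-formed expression.\<close>

primrec wexpr :: "wf \<Rightarrow> expression" and cexpr :: "cl \<Rightarrow> expression" where
  "wexpr (Neg p) = Cn ''-.'' # wexpr p"
| "wexpr (Imp p q) = [Cn ''(''] @ wexpr p @ [Cn ''->''] @ wexpr q @ [Cn '')'']"
| "wexpr (Iff p q) = [Cn ''(''] @ wexpr p @ [Cn ''<->''] @ wexpr q @ [Cn '')'']"
| "wexpr (Or p q) = [Cn ''(''] @ wexpr p @ [Cn (unescape ''%/'')] @ wexpr q @ [Cn '')'']"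
| "wexpr (And p q) = [Cn ''(''] @ wexpr p @ [Cn (unescape ''/%'')] @ wexpr q @ [Cn '')'']"
| "wexpr (And3 p q r) = [Cn ''(''] @ wexpr p @ [Cn (unescape ''/%'')] @ wexpr q
     @ [Cn (unescape ''/%'')] @ wexpr r @ [Cn '')'']"
| "wexpr (All x p) = [Cn ''A.'', Vr x] @ wexpr p"
| "wexpr (Ex x p) = [Cn ''E.'', Vr x] @ wexpr p"
| "wexpr (Sb y x p) = [Cn ''['', Vr y, Cn ''/'', Vr x, Cn '']''] @ wexpr p"
| "wexpr (Eq A B) = cexpr A @ [Cn ''=''] @ cexpr B"
| "wexpr (Mem A B) = cexpr A @ [Cn ''e.''] @ cexpr B"
| "wexpr (Ne A B) = cexpr A @ [Cn ''=/=''] @ cexpr B"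
| "wexpr (Rex x A p) = [Cn ''E.'', Vr x, Cn ''e.''] @ cexpr A @ wexpr p"
| "wexpr (Ss A B) = cexpr A @ [Cn ''C_''] @ cexpr B"
| "wexpr (Br A R B) = cexpr A @ cexpr R @ cexpr B"
| "cexpr (Con c) = [Cn (if c \<in> constants then c else ''0'')]"
| "cexpr (SV x) = [Vr x]"
| "cexpr (Ab x p) = [Cn ''{'', Vr x, Cn ''|''] @ wexpr p @ [Cn ''}'']"
| "cexpr (Cup A B) = [Cn ''(''] @ cexpr A @ [Cn ''u.''] @ cexpr B @ [Cn '')'']"
| "cexpr (Cap A B) = [Cn ''(''] @ cexpr A @ [Cn ''i^i''] @ cexpr B @ [Cn '')'']"
| "cexpr (Sn A) = [Cn ''{''] @ cexpr A @ [Cn ''}'']"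
| "cexpr (Pr A B) = [Cn ''{''] @ cexpr A @ [Cn '',''] @ cexpr B @ [Cn ''}'']"
| "cexpr (Op A B) = [Cn ''<.''] @ cexpr A @ [Cn '',''] @ cexpr B @ [Cn ''>.'']"
| "cexpr (Uni A) = Cn ''U.'' # cexpr A"
| "cexpr (Opab x y p) = [Cn ''{'', Cn ''<.'', Vr x, Cn '','', Vr y, Cn ''>.'', Cn ''|'']
     @ wexpr p @ [Cn ''}'']"
| "cexpr (Xp A B) = [Cn ''(''] @ cexpr A @ [Cn ''X.''] @ cexpr B @ [Cn '')'']"
| "cexpr (Iota x p) = [Cn ''('', Cn ''iota'', Vr x] @ wexpr p @ [Cn '')'']"
| "cexpr (Fv F A) = [Cn ''(''] @ cexpr F @ [Cn ''`''] @ cexpr A @ [Cn '')'']"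
| "cexpr (Ov A F B) = [Cn ''(''] @ cexpr A @ cexpr F @ cexpr B @ [Cn '')'']"

lemma core_memI:
  "F \<in> set propositional_part \<Longrightarrow> F \<in> setmm_core"
  "F \<in> set predicate_part \<Longrightarrow> F \<in> setmm_core"
  "F \<in> set zfc_part \<Longrightarrow> F \<in> setmm_core"
  "F \<in> set class_part \<Longrightarrow> F \<in> setmm_core"
  "F \<in> set complex_part \<Longrightarrow> F \<in> setmm_core"
  by (simp_all add: setmm_core_def)

lemmas part_simps = propositional_part_def predicate_part_def zfc_part_def class_part_def
  complex_part_def list.set insert_iff simp_thms

lemmas parse = mm_def tokens_def unescape_def var_type_def subst_def

text \<open>This and the next fact type the default values of \<open>asg\<close>, and so are derived
  straight from \<open>closure\<close>, ahead of \<open>core_rule\<close>.\<close>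

lemma class_zero: "Cn ''class'' # [Cn ''0''] \<in> Cl UNIV"
proof -
  have "ax ''class 0'' \<in> setmm_core"
    by (rule core_memI(5)) (simp only: part_simps)
  from closure.axiom_instance[OF this[unfolded axd_def],
    where \<sigma> = "\<lambda>_. []" and D = "pairs UNIV" and T = "setvars UNIV" and H = "{}"]
  show ?thesis by (simp add: parse frame_vars_def vars_def)
qed

lemma wff_zero_eq_zero: "Cn ''wff'' # [Cn ''0'', Cn ''='', Cn ''0''] \<in> Cl UNIV"
proof -
  have "ax ''wff A = B'' \<in> setmm_core"
    by (rule core_memI(2)) (simp only: part_simps)
  from closure.axiom_instance[OF this[unfolded axd_def],
    where \<sigma> = "\<lambda>_. [Cn ''0'']" and D = "pairs UNIV" and T = "setvars UNIV" and H = "{}"]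
  show ?thesis using class_zero by (force simp: parse frame_vars_def vars_def split: if_splits)
qed

text \<open>Variables without a listed value get a well-typed default value, so that no variable of
  an axiom has to be checked for having a value.\<close>

definition asg :: "(string \<times> expression) list \<Rightarrow> string \<Rightarrow> expression" where
  "asg l v = (case map_of l v of Some e \<Rightarrow> e
     | None \<Rightarrow> (if var_type v = Some ''wff'' then [Cn ''0'', Cn ''='', Cn ''0'']
                else if var_type v = Some ''setvar'' then [Vr ''x'']
                else [Cn ''0'']))"

lemma var_type_cases: "var_type v = Some t \<Longrightarrow> t = ''wff'' \<or> t = ''setvar'' \<or> t = ''class''"
  unfolding var_type_def by (drule map_of_SomeD) auto

lemma setvar_Cl [simp]: "Cn ''setvar'' # [Vr x] \<in> Cl UNIV"
  by (rule closure.type_hyp) (simp add: setvars_def)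

text \<open>A form of the instance rule in which every side condition ranges over an explicit list,
  so that the simplifier can parse the statement, substitute and check it. Since
  \<open>pairs UNIV\<close> declares any two different variables distinct, a \<open>$d\<close>
  condition turns into disjointness of variable sets.\<close>

lemma core_rule:
  assumes core: "axd ds hs a \<in> setmm_core"
    and ty: "\<forall>(v, e)\<in>set l. Cn (the (var_type v)) # e \<in> Cl UNIV"
    and hyp: "\<forall>h\<in>set hs. subst (asg l) (mm h) \<in> Cl UNIV"
    and dv: "\<forall>d\<in>set ds. \<forall>p\<in>set (tokens d). \<forall>q\<in>set (tokens d). p \<noteq> q \<longrightarrow>
               vars (asg l p) \<inter> vars (asg l q) = {}"
    and e: "subst (asg l) (mm a) = e"
  shows "e \<in> Cl UNIV"
  unfolding e[symmetric]
proof (rule closure.axiom_instance[OF core[unfolded axd_def]])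
  fix c v
  assume "(c, v) \<in> {(c, v). v \<in> frame_vars (mm ` set hs) (mm a) \<and> var_type v = Some c}"
  then have c: "var_type v = Some c" by simp
  show "Cn c # asg l v \<in> Cl UNIV"
  proof (cases "map_of l v")
    case None
    then show ?thesis
      using var_type_cases[OF c] c class_zero wff_zero_eq_zero by (auto simp: asg_def)
  next
    case (Some e)
    then have "(v, e) \<in> set l" by (rule map_of_SomeD)
    then show ?thesis using ty c Some by (auto simp: asg_def)
  qed
next
  fix p q x y
  assume "{p, q} \<in> {{p, q} | p q d. d \<in> set ds \<and> p \<in> set (tokens d) \<and> q \<in> set (tokens d) \<and> p \<noteq> q}"
    and xy: "x \<in> vars (asg l p)" "y \<in> vars (asg l q)"
  then obtain d where "d \<in> set ds" "p \<in> set (tokens d)" "q \<in> set (tokens d)" "p \<noteq> q"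
    by (auto simp: doubleton_eq_iff)
  then show "{x, y} \<in> pairs UNIV" using dv xy unfolding pairs_iff by blast
qed (use hyp in auto)

section \<open>Formation rules of set.mm\<close>

lemma wff_Neg:
  "Cn ''wff'' # wexpr p \<in> Cl UNIV \<Longrightarrow>
   Cn ''wff'' # wexpr (Neg p) \<in> Cl UNIV"
  by (rule core_rule[OF core_memI(1), of "[]" "[]"
      "''wff -. ph''"
      "[(''ph'', wexpr p)]"])
    (simp only: part_simps, simp_all add: parse asg_def)

lemma wff_Imp:
  "Cn ''wff'' # wexpr p \<in> Cl UNIV \<Longrightarrow>
   Cn ''wff'' # wexpr q \<in> Cl UNIV \<Longrightarrow>
   Cn ''wff'' # wexpr (Imp p q) \<in> Cl UNIV"
  by (rule core_rule[OF core_memI(1), of "[]" "[]"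
      "''wff ( ph -> ps )''"
      "[(''ph'', wexpr p), (''ps'', wexpr q)]"])
    (simp only: part_simps, simp_all add: parse asg_def)

lemma wff_Iff:
  "Cn ''wff'' # wexpr p \<in> Cl UNIV \<Longrightarrow>
   Cn ''wff'' # wexpr q \<in> Cl UNIV \<Longrightarrow>
   Cn ''wff'' # wexpr (Iff p q) \<in> Cl UNIV"
  by (rule core_rule[OF core_memI(1), of "[]" "[]"
      "''wff ( ph <-> ps )''"
      "[(''ph'', wexpr p), (''ps'', wexpr q)]"])
    (simp only: part_simps, simp_all add: parse asg_def)

lemma wff_Or:
  "Cn ''wff'' # wexpr p \<in> Cl UNIV \<Longrightarrow>
   Cn ''wff'' # wexpr q \<in> Cl UNIV \<Longrightarrow>
   Cn ''wff'' # wexpr (Or p q) \<in> Cl UNIV"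
  by (rule core_rule[OF core_memI(1), of "[]" "[]"
      "''wff ( ph %/ ps )''"
      "[(''ph'', wexpr p), (''ps'', wexpr q)]"])
    (simp only: part_simps, simp_all add: parse asg_def)

lemma wff_And:
  "Cn ''wff'' # wexpr p \<in> Cl UNIV \<Longrightarrow>
   Cn ''wff'' # wexpr q \<in> Cl UNIV \<Longrightarrow>
   Cn ''wff'' # wexpr (And p q) \<in> Cl UNIV"
  by (rule core_rule[OF core_memI(1), of "[]" "[]"
      "''wff ( ph /% ps )''"
      "[(''ph'', wexpr p), (''ps'', wexpr q)]"])
    (simp only: part_simps, simp_all add: parse asg_def)

lemma wff_And3:
  "Cn ''wff'' # wexpr p \<in> Cl UNIV \<Longrightarrow>
   Cn ''wff'' # wexpr q \<in> Cl UNIV \<Longrightarrow>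
   Cn ''wff'' # wexpr r \<in> Cl UNIV \<Longrightarrow>
   Cn ''wff'' # wexpr (And3 p q r) \<in> Cl UNIV"
  by (rule core_rule[OF core_memI(1), of "[]" "[]"
      "''wff ( ph /% ps /% ch )''"
      "[(''ph'', wexpr p), (''ps'', wexpr q), (''ch'', wexpr r)]"])
    (simp only: part_simps, simp_all add: parse asg_def)

lemma wff_All:
  "Cn ''wff'' # wexpr p \<in> Cl UNIV \<Longrightarrow>
   Cn ''wff'' # wexpr (All x p) \<in> Cl UNIV"
  by (rule core_rule[OF core_memI(2), of "[]" "[]"
      "''wff A. x ph''"
      "[(''ph'', wexpr p), (''x'', [Vr x])]"])
    (simp only: part_simps, simp_all add: parse asg_def)

lemma wff_Ex:
  "Cn ''wff'' # wexpr p \<in> Cl UNIV \<Longrightarrow>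
   Cn ''wff'' # wexpr (Ex x p) \<in> Cl UNIV"
  by (rule core_rule[OF core_memI(2), of "[]" "[]"
      "''wff E. x ph''"
      "[(''ph'', wexpr p), (''x'', [Vr x])]"])
    (simp only: part_simps, simp_all add: parse asg_def)

lemma wff_Sb:
  "Cn ''wff'' # wexpr p \<in> Cl UNIV \<Longrightarrow>
   Cn ''wff'' # wexpr (Sb y x p) \<in> Cl UNIV"
  by (rule core_rule[OF core_memI(2), of "[]" "[]"
      "''wff [ y / x ] ph''"
      "[(''ph'', wexpr p), (''x'', [Vr x]), (''y'', [Vr y])]"])
    (simp only: part_simps, simp_all add: parse asg_def)

lemma wff_Eq:
  "Cn ''class'' # cexpr A \<in> Cl UNIV \<Longrightarrow>
   Cn ''class'' # cexpr B \<in> Cl UNIV \<Longrightarrow>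
   Cn ''wff'' # wexpr (Eq A B) \<in> Cl UNIV"
  by (rule core_rule[OF core_memI(2), of "[]" "[]"
      "''wff A = B''"
      "[(''A'', cexpr A), (''B'', cexpr B)]"])
    (simp only: part_simps, simp_all add: parse asg_def)

lemma wff_Mem:
  "Cn ''class'' # cexpr A \<in> Cl UNIV \<Longrightarrow>
   Cn ''class'' # cexpr B \<in> Cl UNIV \<Longrightarrow>
   Cn ''wff'' # wexpr (Mem A B) \<in> Cl UNIV"
  by (rule core_rule[OF core_memI(2), of "[]" "[]"
      "''wff A e. B''"
      "[(''A'', cexpr A), (''B'', cexpr B)]"])
    (simp only: part_simps, simp_all add: parse asg_def)

lemma wff_Ne:
  "Cn ''class'' # cexpr A \<in> Cl UNIV \<Longrightarrow>
   Cn ''class'' # cexpr B \<in> Cl UNIV \<Longrightarrow>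
   Cn ''wff'' # wexpr (Ne A B) \<in> Cl UNIV"
  by (rule core_rule[OF core_memI(4), of "[]" "[]"
      "''wff A =/= B''"
      "[(''A'', cexpr A), (''B'', cexpr B)]"])
    (simp only: part_simps, simp_all add: parse asg_def)

lemma wff_Rex:
  "Cn ''wff'' # wexpr p \<in> Cl UNIV \<Longrightarrow>
   Cn ''class'' # cexpr A \<in> Cl UNIV \<Longrightarrow>
   Cn ''wff'' # wexpr (Rex x A p) \<in> Cl UNIV"
  by (rule core_rule[OF core_memI(4), of "[]" "[]"
      "''wff E. x e. A ph''"
      "[(''ph'', wexpr p), (''x'', [Vr x]), (''A'', cexpr A)]"])
    (simp only: part_simps, simp_all add: parse asg_def)

lemma wff_Ss:
  "Cn ''class'' # cexpr A \<in> Cl UNIV \<Longrightarrow>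
   Cn ''class'' # cexpr B \<in> Cl UNIV \<Longrightarrow>
   Cn ''wff'' # wexpr (Ss A B) \<in> Cl UNIV"
  by (rule core_rule[OF core_memI(4), of "[]" "[]"
      "''wff A C_ B''"
      "[(''A'', cexpr A), (''B'', cexpr B)]"])
    (simp only: part_simps, simp_all add: parse asg_def)

lemma wff_Br:
  "Cn ''class'' # cexpr A \<in> Cl UNIV \<Longrightarrow>
   Cn ''class'' # cexpr B \<in> Cl UNIV \<Longrightarrow>
   Cn ''class'' # cexpr R \<in> Cl UNIV \<Longrightarrow>
   Cn ''wff'' # wexpr (Br A R B) \<in> Cl UNIV"
  by (rule core_rule[OF core_memI(4), of "[]" "[]"
      "''wff A R B''"
      "[(''A'', cexpr A), (''B'', cexpr B), (''R'', cexpr R)]"])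
    (simp only: part_simps, simp_all add: parse asg_def)

lemma class_SV:
  "Cn ''class'' # cexpr (SV x) \<in> Cl UNIV"
  by (rule core_rule[OF core_memI(2), of "[]" "[]"
      "''class x''"
      "[(''x'', [Vr x])]"])
    (simp only: part_simps, simp_all add: parse asg_def)

lemma class_Ab:
  "Cn ''wff'' # wexpr p \<in> Cl UNIV \<Longrightarrow>
   Cn ''class'' # cexpr (Ab x p) \<in> Cl UNIV"
  by (rule core_rule[OF core_memI(4), of "[]" "[]"
      "''class { x | ph }''"
      "[(''ph'', wexpr p), (''x'', [Vr x])]"])
    (simp only: part_simps, simp_all add: parse asg_def)

lemma class_Cup:
  "Cn ''class'' # cexpr A \<in> Cl UNIV \<Longrightarrow>
   Cn ''class'' # cexpr B \<in> Cl UNIV \<Longrightarrow>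
   Cn ''class'' # cexpr (Cup A B) \<in> Cl UNIV"
  by (rule core_rule[OF core_memI(4), of "[]" "[]"
      "''class ( A u. B )''"
      "[(''A'', cexpr A), (''B'', cexpr B)]"])
    (simp only: part_simps, simp_all add: parse asg_def)

lemma class_Cap:
  "Cn ''class'' # cexpr A \<in> Cl UNIV \<Longrightarrow>
   Cn ''class'' # cexpr B \<in> Cl UNIV \<Longrightarrow>
   Cn ''class'' # cexpr (Cap A B) \<in> Cl UNIV"
  by (rule core_rule[OF core_memI(4), of "[]" "[]"
      "''class ( A i^i B )''"
      "[(''A'', cexpr A), (''B'', cexpr B)]"])
    (simp only: part_simps, simp_all add: parse asg_def)

lemma class_Sn:
  "Cn ''class'' # cexpr A \<in> Cl UNIV \<Longrightarrow>
   Cn ''class'' # cexpr (Sn A) \<in> Cl UNIV"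
  by (rule core_rule[OF core_memI(4), of "[]" "[]"
      "''class { A }''"
      "[(''A'', cexpr A)]"])
    (simp only: part_simps, simp_all add: parse asg_def)

lemma class_Pr:
  "Cn ''class'' # cexpr A \<in> Cl UNIV \<Longrightarrow>
   Cn ''class'' # cexpr B \<in> Cl UNIV \<Longrightarrow>
   Cn ''class'' # cexpr (Pr A B) \<in> Cl UNIV"
  by (rule core_rule[OF core_memI(4), of "[]" "[]"
      "''class { A , B }''"
      "[(''A'', cexpr A), (''B'', cexpr B)]"])
    (simp only: part_simps, simp_all add: parse asg_def)

lemma class_Op:
  "Cn ''class'' # cexpr A \<in> Cl UNIV \<Longrightarrow>
   Cn ''class'' # cexpr B \<in> Cl UNIV \<Longrightarrow>
   Cn ''class'' # cexpr (Op A B) \<in> Cl UNIV"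
  by (rule core_rule[OF core_memI(4), of "[]" "[]"
      "''class <. A , B >.''"
      "[(''A'', cexpr A), (''B'', cexpr B)]"])
    (simp only: part_simps, simp_all add: parse asg_def)

lemma class_Uni:
  "Cn ''class'' # cexpr A \<in> Cl UNIV \<Longrightarrow>
   Cn ''class'' # cexpr (Uni A) \<in> Cl UNIV"
  by (rule core_rule[OF core_memI(4), of "[]" "[]"
      "''class U. A''"
      "[(''A'', cexpr A)]"])
    (simp only: part_simps, simp_all add: parse asg_def)

lemma class_Opab:
  "Cn ''wff'' # wexpr p \<in> Cl UNIV \<Longrightarrow>
   Cn ''class'' # cexpr (Opab x y p) \<in> Cl UNIV"
  by (rule core_rule[OF core_memI(4), of "[]" "[]"
      "''class { <. x , y >. | ph }''"
      "[(''ph'', wexpr p), (''x'', [Vr x]), (''y'', [Vr y])]"])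
    (simp only: part_simps, simp_all add: parse asg_def)

lemma class_Xp:
  "Cn ''class'' # cexpr A \<in> Cl UNIV \<Longrightarrow>
   Cn ''class'' # cexpr B \<in> Cl UNIV \<Longrightarrow>
   Cn ''class'' # cexpr (Xp A B) \<in> Cl UNIV"
  by (rule core_rule[OF core_memI(4), of "[]" "[]"
      "''class ( A X. B )''"
      "[(''A'', cexpr A), (''B'', cexpr B)]"])
    (simp only: part_simps, simp_all add: parse asg_def)

lemma class_Iota:
  "Cn ''wff'' # wexpr p \<in> Cl UNIV \<Longrightarrow>
   Cn ''class'' # cexpr (Iota x p) \<in> Cl UNIV"
  by (rule core_rule[OF core_memI(4), of "[]" "[]"
      "''class ( iota x ph )''"
      "[(''ph'', wexpr p), (''x'', [Vr x])]"])
    (simp only: part_simps, simp_all add: parse asg_def)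

lemma class_Fv:
  "Cn ''class'' # cexpr A \<in> Cl UNIV \<Longrightarrow>
   Cn ''class'' # cexpr F \<in> Cl UNIV \<Longrightarrow>
   Cn ''class'' # cexpr (Fv F A) \<in> Cl UNIV"
  by (rule core_rule[OF core_memI(4), of "[]" "[]"
      "''class ( F ` A )''"
      "[(''A'', cexpr A), (''F'', cexpr F)]"])
    (simp only: part_simps, simp_all add: parse asg_def)

lemma class_Ov:
  "Cn ''class'' # cexpr A \<in> Cl UNIV \<Longrightarrow>
   Cn ''class'' # cexpr B \<in> Cl UNIV \<Longrightarrow>
   Cn ''class'' # cexpr F \<in> Cl UNIV \<Longrightarrow>
   Cn ''class'' # cexpr (Ov A F B) \<in> Cl UNIV"
  by (rule core_rule[OF core_memI(4), of "[]" "[]"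
      "''class ( A F B )''"
      "[(''A'', cexpr A), (''B'', cexpr B), (''F'', cexpr F)]"])
    (simp only: part_simps, simp_all add: parse asg_def)

text \<open>\<open>constants\<close> is an explicit finite list, so the claim splits into one
  formation axiom per name; \<open>c3\<close> also settles every other name, which is read as
  \<open>0\<close>.\<close>

lemma class_Con: "Cn ''class'' # cexpr (Con c) \<in> Cl UNIV"
proof -
  have c0: "Cn ''class'' # [Cn ''_V''] \<in> Cl UNIV"
    by (rule core_rule[OF core_memI(4), of "[]" "[]" "''class _V''" "[]"])
      (simp only: part_simps, simp_all add: parse asg_def)
  have c1: "Cn ''class'' # [Cn ''CC''] \<in> Cl UNIV"
    by (rule core_rule[OF core_memI(5), of "[]" "[]" "''class CC''" "[]"])
      (simp only: part_simps, simp_all add: parse asg_def)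
  have c2: "Cn ''class'' # [Cn ''RR''] \<in> Cl UNIV"
    by (rule core_rule[OF core_memI(5), of "[]" "[]" "''class RR''" "[]"])
      (simp only: part_simps, simp_all add: parse asg_def)
  have c3: "Cn ''class'' # [Cn ''0''] \<in> Cl UNIV"
    by (rule core_rule[OF core_memI(5), of "[]" "[]" "''class 0''" "[]"])
      (simp only: part_simps, simp_all add: parse asg_def)
  have c4: "Cn ''class'' # [Cn ''1''] \<in> Cl UNIV"
    by (rule core_rule[OF core_memI(5), of "[]" "[]" "''class 1''" "[]"])
      (simp only: part_simps, simp_all add: parse asg_def)
  have c5: "Cn ''class'' # [Cn ''_i''] \<in> Cl UNIV"
    by (rule core_rule[OF core_memI(5), of "[]" "[]" "''class _i''" "[]"])
      (simp only: part_simps, simp_all add: parse asg_def)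
  have c6: "Cn ''class'' # [Cn ''+''] \<in> Cl UNIV"
    by (rule core_rule[OF core_memI(5), of "[]" "[]" "''class +''" "[]"])
      (simp only: part_simps, simp_all add: parse asg_def)
  have c7: "Cn ''class'' # [Cn ''<RR''] \<in> Cl UNIV"
    by (rule core_rule[OF core_memI(5), of "[]" "[]" "''class <RR''" "[]"])
      (simp only: part_simps, simp_all add: parse asg_def)
  have c8: "Cn ''class'' # [Cn ''x.''] \<in> Cl UNIV"
    by (rule core_rule[OF core_memI(5), of "[]" "[]" "''class x.''" "[]"])
      (simp only: part_simps, simp_all add: parse asg_def)
  have c9: "Cn ''class'' # [Cn ''+oo''] \<in> Cl UNIV"
    by (rule core_rule[OF core_memI(5), of "[]" "[]" "''class +oo''" "[]"])
      (simp only: part_simps, simp_all add: parse asg_def)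
  have c10: "Cn ''class'' # [Cn ''-oo''] \<in> Cl UNIV"
    by (rule core_rule[OF core_memI(5), of "[]" "[]" "''class -oo''" "[]"])
      (simp only: part_simps, simp_all add: parse asg_def)
  have c11: "Cn ''class'' # [Cn ''<''] \<in> Cl UNIV"
    by (rule core_rule[OF core_memI(5), of "[]" "[]" "''class <''" "[]"])
      (simp only: part_simps, simp_all add: parse asg_def)
  have c12: "Cn ''class'' # [Cn ''2''] \<in> Cl UNIV"
    by (rule core_rule[OF core_memI(5), of "[]" "[]" "''class 2''" "[]"])
      (simp only: part_simps, simp_all add: parse asg_def)
  have c13: "Cn ''class'' # [Cn ''3''] \<in> Cl UNIV"
    by (rule core_rule[OF core_memI(5), of "[]" "[]" "''class 3''" "[]"])
      (simp only: part_simps, simp_all add: parse asg_def)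
  have c14: "Cn ''class'' # [Cn ''4''] \<in> Cl UNIV"
    by (rule core_rule[OF core_memI(5), of "[]" "[]" "''class 4''" "[]"])
      (simp only: part_simps, simp_all add: parse asg_def)
  have c15: "Cn ''class'' # [Cn ''5''] \<in> Cl UNIV"
    by (rule core_rule[OF core_memI(5), of "[]" "[]" "''class 5''" "[]"])
      (simp only: part_simps, simp_all add: parse asg_def)
  have c16: "Cn ''class'' # [Cn ''6''] \<in> Cl UNIV"
    by (rule core_rule[OF core_memI(5), of "[]" "[]" "''class 6''" "[]"])
      (simp only: part_simps, simp_all add: parse asg_def)
  have c17: "Cn ''class'' # [Cn ''7''] \<in> Cl UNIV"
    by (rule core_rule[OF core_memI(5), of "[]" "[]" "''class 7''" "[]"])
      (simp only: part_simps, simp_all add: parse asg_def)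
  have c18: "Cn ''class'' # [Cn ''8''] \<in> Cl UNIV"
    by (rule core_rule[OF core_memI(5), of "[]" "[]" "''class 8''" "[]"])
      (simp only: part_simps, simp_all add: parse asg_def)
  have c19: "Cn ''class'' # [Cn ''9''] \<in> Cl UNIV"
    by (rule core_rule[OF core_memI(5), of "[]" "[]" "''class 9''" "[]"])
      (simp only: part_simps, simp_all add: parse asg_def)
  have c20: "Cn ''class'' # [Cn ''10''] \<in> Cl UNIV"
    by (rule core_rule[OF core_memI(5), of "[]" "[]" "''class 10''" "[]"])
      (simp only: part_simps, simp_all add: parse asg_def)
  show ?thesis
    using c0 c1 c2 c3 c4 c5 c6 c7 c8 c9 c10 c11 c12 c13 c14 c15 c16 c17 c18 c19 c20
    by (auto simp: constants_def parse)
qed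

text \<open>Registered as simplification rules, these discharge the typing premises whenever an
  axiom is instantiated.\<close>

lemma wff_class: "Cn ''wff'' # wexpr p \<in> Cl UNIV" "Cn ''class'' # cexpr A \<in> Cl UNIV"
  by (induction p and A)
    (assumption | rule class_Con
      wff_Neg wff_Imp wff_Iff wff_Or wff_And wff_And3 wff_All wff_Ex wff_Sb
      wff_Eq wff_Mem wff_Ne wff_Rex wff_Ss wff_Br
      class_SV class_Ab class_Cup class_Cap class_Sn class_Pr class_Op
      class_Uni class_Opab class_Xp class_Iota class_Fv class_Ov)+

declare wff_class [simp]

definition Thm :: "wf \<Rightarrow> bool" where
  "Thm p \<longleftrightarrow> Cn ''|-'' # wexpr p \<in> Cl UNIV"

lemma vars_simps [simp]:
  "vars [] = {}" "vars (Cn c # e) = vars e" "vars (Vr v # e) = insert v (vars e)"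
  "vars (e @ f) = vars e \<union> vars f"
  by (auto simp: vars_def)

abbreviation "RR \<equiv> Con ''RR''"
abbreviation "CC \<equiv> Con ''CC''"
abbreviation "zero \<equiv> Con ''0''"
abbreviation "one \<equiv> Con ''1''"
abbreviation "im \<equiv> Con ''_i''"

abbreviation add (infixl "\<^bold>+" 65) where "A \<^bold>+ B \<equiv> Ov A (Con ''+'') B"
abbreviation mul (infixl "\<^bold>*" 70) where "A \<^bold>* B \<equiv> Ov A (Con ''x.'') B"
text \<open>This is the order \<open><RR\<close> of the axioms; the \<open><\<close> of the extended
  reals is always written out as \<open>Con ''<''\<close>.\<close>

abbreviation rlt (infix "\<^bold><" 50) where "A \<^bold>< B \<equiv> Br A (Con ''<RR'') B"

section \<open>The axioms as schemes\<close>

lemma ax_mp: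
  assumes "Thm p" and "Thm (p \<^bold>\<longrightarrow> q)"
  shows "Thm (q)"
  unfolding Thm_def
  by (rule core_rule[OF core_memI(1), of "[]" "[''|- ph'', ''|- ( ph -> ps )'']"
      "''|- ps''"
      "[(''ph'', wexpr p), (''ps'', wexpr q)]"])
    \<comment> \<open>Checking a hypothesis of the rule leaves its expression with
      \<open>wexpr\<close> unfolded, so the assumptions are also supplied in that form.\<close>
    (simp only: part_simps, simp_all add: assms parse asg_def assms[unfolded Thm_def, simplified])

lemma ax1:
  "Thm (p \<^bold>\<longrightarrow> q \<^bold>\<longrightarrow> p)"
  unfolding Thm_def
  by (rule core_rule[OF core_memI(1), of "[]" "[]"
      "''|- ( ph -> ( ps -> ph ) )''"
      "[(''ph'', wexpr p), (''ps'', wexpr q)]"])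
    (simp only: part_simps, simp_all add: parse asg_def)

lemma ax2:
  "Thm ((p \<^bold>\<longrightarrow> q \<^bold>\<longrightarrow> r) \<^bold>\<longrightarrow> (p \<^bold>\<longrightarrow> q) \<^bold>\<longrightarrow> p \<^bold>\<longrightarrow> r)"
  unfolding Thm_def
  by (rule core_rule[OF core_memI(1), of "[]" "[]"
      "''|- ( ( ph -> ( ps -> ch ) ) -> ( ( ph -> ps ) -> ( ph -> ch ) ) )''"
      "[(''ph'', wexpr p), (''ps'', wexpr q), (''ch'', wexpr r)]"])
    (simp only: part_simps, simp_all add: parse asg_def)

lemma ax3:
  "Thm ((\<^bold>\<not> p \<^bold>\<longrightarrow> \<^bold>\<not> q) \<^bold>\<longrightarrow> q \<^bold>\<longrightarrow> p)"
  unfolding Thm_def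
  by (rule core_rule[OF core_memI(1), of "[]" "[]"
      "''|- ( ( -. ph -> -. ps ) -> ( ps -> ph ) )''"
      "[(''ph'', wexpr p), (''ps'', wexpr q)]"])
    (simp only: part_simps, simp_all add: parse asg_def)

lemma df_bi:
  "Thm (\<^bold>\<not> (((p \<^bold>\<longleftrightarrow> q) \<^bold>\<longrightarrow> \<^bold>\<not> ((p \<^bold>\<longrightarrow> q) \<^bold>\<longrightarrow> \<^bold>\<not> (q \<^bold>\<longrightarrow> p))) \<^bold>\<longrightarrow> \<^bold>\<not> (\<^bold>\<not> ((p \<^bold>\<longrightarrow> q) \<^bold>\<longrightarrow> \<^bold>\<not> (q \<^bold>\<longrightarrow> p)) \<^bold>\<longrightarrow> (p \<^bold>\<longleftrightarrow> q))))"
  unfolding Thm_def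
  by (rule core_rule[OF core_memI(1), of "[]" "[]"
      "''|- -. ( ( ( ph <-> ps ) -> -. ( ( ph -> ps ) -> -. ( ps -> ph ) ) ) -> -. ( -. ( ( ph -> ps ) -> -. ( ps -> ph ) ) -> ( ph <-> ps ) ) )''"
      "[(''ph'', wexpr p), (''ps'', wexpr q)]"])
    (simp only: part_simps, simp_all add: parse asg_def)

lemma df_or:
  "Thm ((p \<^bold>\<or> q) \<^bold>\<longleftrightarrow> (\<^bold>\<not> p \<^bold>\<longrightarrow> q))"
  unfolding Thm_def
  by (rule core_rule[OF core_memI(1), of "[]" "[]"
      "''|- ( ( ph %/ ps ) <-> ( -. ph -> ps ) )''"
      "[(''ph'', wexpr p), (''ps'', wexpr q)]"])
    (simp only: part_simps, simp_all add: parse asg_def)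

lemma df_an:
  "Thm ((p \<^bold>\<and> q) \<^bold>\<longleftrightarrow> \<^bold>\<not> (p \<^bold>\<longrightarrow> \<^bold>\<not> q))"
  unfolding Thm_def
  by (rule core_rule[OF core_memI(1), of "[]" "[]"
      "''|- ( ( ph /% ps ) <-> -. ( ph -> -. ps ) )''"
      "[(''ph'', wexpr p), (''ps'', wexpr q)]"])
    (simp only: part_simps, simp_all add: parse asg_def)

lemma df_3an:
  "Thm (And3 p q r \<^bold>\<longleftrightarrow> ((p \<^bold>\<and> q) \<^bold>\<and> r))"
  unfolding Thm_def
  by (rule core_rule[OF core_memI(1), of "[]" "[]"
      "''|- ( ( ph /% ps /% ch ) <-> ( ( ph /% ps ) /% ch ) )''"
      "[(''ph'', wexpr p), (''ps'', wexpr q), (''ch'', wexpr r)]"])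
    (simp only: part_simps, simp_all add: parse asg_def)

section \<open>Predicate calculus with equality\<close>

lemma ax_gen:
  assumes "Thm p"
  shows "Thm (All x p)"
  unfolding Thm_def
  by (rule core_rule[OF core_memI(2), of "[]" "[''|- ph'']"
      "''|- A. x ph''"
      "[(''ph'', wexpr p), (''x'', [Vr x])]"])
    (simp only: part_simps, simp_all add: assms parse asg_def assms[unfolded Thm_def, simplified])

lemma ax4:
  "Thm (All x (p \<^bold>\<longrightarrow> q) \<^bold>\<longrightarrow> All x p \<^bold>\<longrightarrow> All x q)"
  unfolding Thm_def
  by (rule core_rule[OF core_memI(2), of "[]" "[]"
      "''|- ( A. x ( ph -> ps ) -> ( A. x ph -> A. x ps ) )''"
      "[(''ph'', wexpr p), (''ps'', wexpr q), (''x'', [Vr x])]"])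
    (simp only: part_simps, simp_all add: parse asg_def)

lemma ax5:
  assumes "x \<notin> vars (wexpr p)"
  shows "Thm (p \<^bold>\<longrightarrow> All x p)"
  unfolding Thm_def
  by (rule core_rule[OF core_memI(2), of "[''x ph'']" "[]"
      "''|- ( ph -> A. x ph )''"
      "[(''ph'', wexpr p), (''x'', [Vr x])]"])
    (simp only: part_simps, simp_all add: assms parse asg_def)

lemma ax6:
  "Thm (\<^bold>\<not> All x (\<^bold>\<not> SV x \<^bold>= SV y))"
  unfolding Thm_def
  by (rule core_rule[OF core_memI(2), of "[]" "[]"
      "''|- -. A. x -. x = y''"
      "[(''x'', [Vr x]), (''y'', [Vr y])]"])
    (simp only: part_simps, simp_all add: parse asg_def)

lemma ax7:
  "Thm (SV x \<^bold>= SV y \<^bold>\<longrightarrow> SV x \<^bold>= SV z \<^bold>\<longrightarrow> SV y \<^bold>= SV z)"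
  unfolding Thm_def
  by (rule core_rule[OF core_memI(2), of "[]" "[]"
      "''|- ( x = y -> ( x = z -> y = z ) )''"
      "[(''x'', [Vr x]), (''y'', [Vr y]), (''z'', [Vr z])]"])
    (simp only: part_simps, simp_all add: parse asg_def)

lemma ax12:
  "Thm (SV x \<^bold>= SV y \<^bold>\<longrightarrow> All y p \<^bold>\<longrightarrow> All x (SV x \<^bold>= SV y \<^bold>\<longrightarrow> p))"
  unfolding Thm_def
  by (rule core_rule[OF core_memI(2), of "[]" "[]"
      "''|- ( x = y -> ( A. y ph -> A. x ( x = y -> ph ) ) )''"
      "[(''ph'', wexpr p), (''x'', [Vr x]), (''y'', [Vr y])]"])
    (simp only: part_simps, simp_all add: parse asg_def)

lemma df_ex:
  "Thm (Ex x p \<^bold>\<longleftrightarrow> \<^bold>\<not> All x (\<^bold>\<not> p))"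
  unfolding Thm_def
  by (rule core_rule[OF core_memI(2), of "[]" "[]"
      "''|- ( E. x ph <-> -. A. x -. ph )''"
      "[(''ph'', wexpr p), (''x'', [Vr x])]"])
    (simp only: part_simps, simp_all add: parse asg_def)

lemma df_sb:
  "Thm (Sb y x p \<^bold>\<longleftrightarrow> ((SV x \<^bold>= SV y \<^bold>\<longrightarrow> p) \<^bold>\<and> Ex x (SV x \<^bold>= SV y \<^bold>\<and> p)))"
  unfolding Thm_def
  by (rule core_rule[OF core_memI(2), of "[]" "[]"
      "''|- ( [ y / x ] ph <-> ( ( x = y -> ph ) /% E. x ( x = y /% ph ) ) )''"
      "[(''ph'', wexpr p), (''x'', [Vr x]), (''y'', [Vr y])]"])
    (simp only: part_simps, simp_all add: parse asg_def)

lemma ax_ext: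
  assumes "x \<noteq> z" and "y \<noteq> z"
  shows "Thm (All z (SV z \<^bold>\<in> SV x \<^bold>\<longleftrightarrow> SV z \<^bold>\<in> SV y) \<^bold>\<longrightarrow> SV x \<^bold>= SV y)"
  unfolding Thm_def
  by (rule core_rule[OF core_memI(3), of "[''x z'', ''y z'']" "[]"
      "''|- ( A. z ( z e. x <-> z e. y ) -> x = y )''"
      "[(''x'', [Vr x]), (''y'', [Vr y]), (''z'', [Vr z])]"])
    (simp only: part_simps, simp_all add: assms parse asg_def assms[symmetric])

section \<open>Class abstractions and defined classes\<close>

lemma df_clab:
  "Thm (SV x \<^bold>\<in> Ab y p \<^bold>\<longleftrightarrow> Sb x y p)"
  unfolding Thm_def
  by (rule core_rule[OF core_memI(4), of "[]" "[]"
      "''|- ( x e. { y | ph } <-> [ x / y ] ph )''"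
      "[(''ph'', wexpr p), (''x'', [Vr x]), (''y'', [Vr y])]"])
    (simp only: part_simps, simp_all add: parse asg_def)

text \<open>df-cleq carries an instance of extensionality as a hypothesis, which
  \<open>ax_ext\<close> discharges. The variables \<open>y\<close> and \<open>z\<close> occur only
  there; \<open>df_cleq\<close> below picks them fresh.\<close>

lemma df_cleq_distinct:
  assumes "x \<notin> vars (cexpr A)" and "x \<notin> vars (cexpr B)" and "x \<noteq> y" and "x \<noteq> z" and "y \<noteq> z"
  shows "Thm (A \<^bold>= B \<^bold>\<longleftrightarrow> All x (SV x \<^bold>\<in> A \<^bold>\<longleftrightarrow> SV x \<^bold>\<in> B))"
  unfolding Thm_def
  by (rule core_rule[OF core_memI(4), of "[''x y z'', ''x A'', ''x B'']"
      "[''|- ( A. x ( x e. y <-> x e. z ) -> y = z )'']"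
      "''|- ( A = B <-> A. x ( x e. A <-> x e. B ) )''"
      "[(''x'', [Vr x]), (''y'', [Vr y]), (''z'', [Vr z]), (''A'', cexpr A), (''B'', cexpr B)]"])
    (simp only: part_simps, simp_all add: assms parse asg_def assms(3,4,5)[symmetric]
      ax_ext[unfolded Thm_def, simplified])

lemma df_clel:
  assumes "x \<notin> vars (cexpr A)" and "x \<notin> vars (cexpr B)"
  shows "Thm (A \<^bold>\<in> B \<^bold>\<longleftrightarrow> Ex x (SV x \<^bold>= A \<^bold>\<and> SV x \<^bold>\<in> B))"
  unfolding Thm_def
  by (rule core_rule[OF core_memI(4), of "[''x A'', ''x B'']" "[]"
      "''|- ( A e. B <-> E. x ( x = A /% x e. B ) )''"
      "[(''x'', [Vr x]), (''A'', cexpr A), (''B'', cexpr B)]"])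
    (simp only: part_simps, simp_all add: assms parse asg_def)

lemma df_ne:
  "Thm (Ne A B \<^bold>\<longleftrightarrow> \<^bold>\<not> A \<^bold>= B)"
  unfolding Thm_def
  by (rule core_rule[OF core_memI(4), of "[]" "[]"
      "''|- ( A =/= B <-> -. A = B )''"
      "[(''A'', cexpr A), (''B'', cexpr B)]"])
    (simp only: part_simps, simp_all add: parse asg_def)

lemma df_rex:
  "Thm (Rex x A p \<^bold>\<longleftrightarrow> Ex x (SV x \<^bold>\<in> A \<^bold>\<and> p))"
  unfolding Thm_def
  by (rule core_rule[OF core_memI(4), of "[]" "[]"
      "''|- ( E. x e. A ph <-> E. x ( x e. A /% ph ) )''"
      "[(''ph'', wexpr p), (''x'', [Vr x]), (''A'', cexpr A)]"])
    (simp only: part_simps, simp_all add: parse asg_def)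

lemma df_un:
  assumes "x \<notin> vars (cexpr A)" and "x \<notin> vars (cexpr B)"
  shows "Thm (Cup A B \<^bold>= Ab x (SV x \<^bold>\<in> A \<^bold>\<or> SV x \<^bold>\<in> B))"
  unfolding Thm_def
  by (rule core_rule[OF core_memI(4), of "[''x A'', ''x B'']" "[]"
      "''|- ( A u. B ) = { x | ( x e. A %/ x e. B ) }''"
      "[(''x'', [Vr x]), (''A'', cexpr A), (''B'', cexpr B)]"])
    (simp only: part_simps, simp_all add: assms parse asg_def)

lemma df_in:
  assumes "x \<notin> vars (cexpr A)" and "x \<notin> vars (cexpr B)"
  shows "Thm (Cap A B \<^bold>= Ab x (SV x \<^bold>\<in> A \<^bold>\<and> SV x \<^bold>\<in> B))"
  unfolding Thm_def
  by (rule core_rule[OF core_memI(4), of "[''x A'', ''x B'']" "[]"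
      "''|- ( A i^i B ) = { x | ( x e. A /% x e. B ) }''"
      "[(''x'', [Vr x]), (''A'', cexpr A), (''B'', cexpr B)]"])
    (simp only: part_simps, simp_all add: assms parse asg_def)

lemma df_ss:
  "Thm (Ss A B \<^bold>\<longleftrightarrow> Cap A B \<^bold>= A)"
  unfolding Thm_def
  by (rule core_rule[OF core_memI(4), of "[]" "[]"
      "''|- ( A C_ B <-> ( A i^i B ) = A )''"
      "[(''A'', cexpr A), (''B'', cexpr B)]"])
    (simp only: part_simps, simp_all add: parse asg_def)

lemma df_sn:
  assumes "x \<notin> vars (cexpr A)"
  shows "Thm (Sn A \<^bold>= Ab x (SV x \<^bold>= A))"
  unfolding Thm_def
  by (rule core_rule[OF core_memI(4), of "[''x A'']" "[]"
      "''|- { A } = { x | x = A }''"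
      "[(''x'', [Vr x]), (''A'', cexpr A)]"])
    (simp only: part_simps, simp_all add: assms parse asg_def)

lemma df_pr:
  "Thm (Pr A B \<^bold>= Cup (Sn A) (Sn B))"
  unfolding Thm_def
  by (rule core_rule[OF core_memI(4), of "[]" "[]"
      "''|- { A , B } = ( { A } u. { B } )''"
      "[(''A'', cexpr A), (''B'', cexpr B)]"])
    (simp only: part_simps, simp_all add: parse asg_def)

lemma df_op:
  assumes "x \<notin> vars (cexpr A)" and "x \<notin> vars (cexpr B)"
  shows "Thm (Op A B \<^bold>= Ab x (And3 (A \<^bold>\<in> Con ''_V'') (B \<^bold>\<in> Con ''_V'') (SV x \<^bold>\<in> Pr (Sn A) (Pr A B))))"
  unfolding Thm_def
  by (rule core_rule[OF core_memI(4), of "[''x A'', ''x B'']" "[]"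
      "''|- <. A , B >. = { x | ( A e. _V /% B e. _V /% x e. { { A } , { A , B } } ) }''"
      "[(''x'', [Vr x]), (''A'', cexpr A), (''B'', cexpr B)]"])
    (simp only: part_simps, simp_all add: assms parse asg_def constants_def)

lemma df_uni:
  assumes "x \<notin> vars (cexpr A)" and "y \<notin> vars (cexpr A)" and "x \<noteq> y"
  shows "Thm (Uni A \<^bold>= Ab x (Ex y (SV x \<^bold>\<in> SV y \<^bold>\<and> SV y \<^bold>\<in> A)))"
  unfolding Thm_def
  by (rule core_rule[OF core_memI(4), of "[''x y A'']" "[]"
      "''|- U. A = { x | E. y ( x e. y /% y e. A ) }''"
      "[(''x'', [Vr x]), (''y'', [Vr y]), (''A'', cexpr A)]"])
    (simp only: part_simps, simp_all add: assms parse asg_def assms(3)[symmetric])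

lemma df_br:
  "Thm (Br A R B \<^bold>\<longleftrightarrow> Op A B \<^bold>\<in> R)"
  unfolding Thm_def
  by (rule core_rule[OF core_memI(4), of "[]" "[]"
      "''|- ( A R B <-> <. A , B >. e. R )''"
      "[(''A'', cexpr A), (''B'', cexpr B), (''R'', cexpr R)]"])
    (simp only: part_simps, simp_all add: parse asg_def)

lemma df_opab:
  assumes "x \<noteq> z" and "y \<noteq> z" and "z \<notin> vars (wexpr p)"
  shows "Thm (Opab x y p \<^bold>= Ab z (Ex x (Ex y (SV z \<^bold>= Op (SV x) (SV y) \<^bold>\<and> p))))"
  unfolding Thm_def
  by (rule core_rule[OF core_memI(4), of "[''x z'', ''y z'', ''z ph'']" "[]"
      "''|- { <. x , y >. | ph } = { z | E. x E. y ( z = <. x , y >. /% ph ) }''"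
      "[(''ph'', wexpr p), (''x'', [Vr x]), (''y'', [Vr y]), (''z'', [Vr z])]"])
    (simp only: part_simps, simp_all add: assms parse asg_def assms(1,2)[symmetric])

lemma df_iota:
  assumes "x \<noteq> y" and "y \<notin> vars (wexpr p)"
  shows "Thm (Iota x p \<^bold>= Uni (Ab y (Ab x p \<^bold>= Sn (SV y))))"
  unfolding Thm_def
  by (rule core_rule[OF core_memI(4), of "[''x y'', ''y ph'']" "[]"
      "''|- ( iota x ph ) = U. { y | { x | ph } = { y } }''"
      "[(''ph'', wexpr p), (''x'', [Vr x]), (''y'', [Vr y])]"])
    (simp only: part_simps, simp_all add: assms parse asg_def assms(1)[symmetric])

lemma df_fv:
  assumes "x \<notin> vars (cexpr A)" and "x \<notin> vars (cexpr F)"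
  shows "Thm (Fv F A \<^bold>= Iota x (Br A F (SV x)))"
  unfolding Thm_def
  by (rule core_rule[OF core_memI(4), of "[''x A'', ''x F'']" "[]"
      "''|- ( F ` A ) = ( iota x A F x )''"
      "[(''x'', [Vr x]), (''A'', cexpr A), (''F'', cexpr F)]"])
    (simp only: part_simps, simp_all add: assms parse asg_def)

lemma df_ov:
  "Thm (Ov A F B \<^bold>= Fv F (Op A B))"
  unfolding Thm_def
  by (rule core_rule[OF core_memI(4), of "[]" "[]"
      "''|- ( A F B ) = ( F ` <. A , B >. )''"
      "[(''A'', cexpr A), (''B'', cexpr B), (''F'', cexpr F)]"])
    (simp only: part_simps, simp_all add: parse asg_def)

section \<open>Axioms for real and complex numbers\<close>

lemma resscn:
  "Thm (Ss RR CC)"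
  unfolding Thm_def
  by (rule core_rule[OF core_memI(5), of "[]" "[]"
      "''|- RR C_ CC''"
      "[]"])
    (simp only: part_simps, simp_all add: parse asg_def constants_def)

lemma one_cn:
  "Thm (one \<^bold>\<in> CC)"
  unfolding Thm_def
  by (rule core_rule[OF core_memI(5), of "[]" "[]"
      "''|- 1 e. CC''"
      "[]"])
    (simp only: part_simps, simp_all add: parse asg_def constants_def)

lemma i_cn:
  "Thm (im \<^bold>\<in> CC)"
  unfolding Thm_def
  by (rule core_rule[OF core_memI(5), of "[]" "[]"
      "''|- _i e. CC''"
      "[]"])
    (simp only: part_simps, simp_all add: parse asg_def constants_def)

lemma addcl:
  "Thm (A \<^bold>\<in> CC \<^bold>\<and> B \<^bold>\<in> CC \<^bold>\<longrightarrow> A \<^bold>+ B \<^bold>\<in> CC)"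
  unfolding Thm_def
  by (rule core_rule[OF core_memI(5), of "[]" "[]"
      "''|- ( ( A e. CC /% B e. CC ) -> ( A + B ) e. CC )''"
      "[(''A'', cexpr A), (''B'', cexpr B)]"])
    (simp only: part_simps, simp_all add: parse asg_def constants_def)

lemma addrcl:
  "Thm (A \<^bold>\<in> RR \<^bold>\<and> B \<^bold>\<in> RR \<^bold>\<longrightarrow> A \<^bold>+ B \<^bold>\<in> RR)"
  unfolding Thm_def
  by (rule core_rule[OF core_memI(5), of "[]" "[]"
      "''|- ( ( A e. RR /% B e. RR ) -> ( A + B ) e. RR )''"
      "[(''A'', cexpr A), (''B'', cexpr B)]"])
    (simp only: part_simps, simp_all add: parse asg_def constants_def)

lemma mulcl:
  "Thm (A \<^bold>\<in> CC \<^bold>\<and> B \<^bold>\<in> CC \<^bold>\<longrightarrow> A \<^bold>* B \<^bold>\<in> CC)"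
  unfolding Thm_def
  by (rule core_rule[OF core_memI(5), of "[]" "[]"
      "''|- ( ( A e. CC /% B e. CC ) -> ( A x. B ) e. CC )''"
      "[(''A'', cexpr A), (''B'', cexpr B)]"])
    (simp only: part_simps, simp_all add: parse asg_def constants_def)

lemma mulrcl:
  "Thm (A \<^bold>\<in> RR \<^bold>\<and> B \<^bold>\<in> RR \<^bold>\<longrightarrow> A \<^bold>* B \<^bold>\<in> RR)"
  unfolding Thm_def
  by (rule core_rule[OF core_memI(5), of "[]" "[]"
      "''|- ( ( A e. RR /% B e. RR ) -> ( A x. B ) e. RR )''"
      "[(''A'', cexpr A), (''B'', cexpr B)]"])
    (simp only: part_simps, simp_all add: parse asg_def constants_def)

lemma mulcom:
  "Thm (A \<^bold>\<in> CC \<^bold>\<and> B \<^bold>\<in> CC \<^bold>\<longrightarrow> A \<^bold>* B \<^bold>= B \<^bold>* A)"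
  unfolding Thm_def
  by (rule core_rule[OF core_memI(5), of "[]" "[]"
      "''|- ( ( A e. CC /% B e. CC ) -> ( A x. B ) = ( B x. A ) )''"
      "[(''A'', cexpr A), (''B'', cexpr B)]"])
    (simp only: part_simps, simp_all add: parse asg_def constants_def)

lemma addass:
  "Thm (And3 (A \<^bold>\<in> CC) (B \<^bold>\<in> CC) (C \<^bold>\<in> CC) \<^bold>\<longrightarrow> A \<^bold>+ B \<^bold>+ C \<^bold>= A \<^bold>+ (B \<^bold>+ C))"
  unfolding Thm_def
  by (rule core_rule[OF core_memI(5), of "[]" "[]"
      "''|- ( ( A e. CC /% B e. CC /% C e. CC ) -> ( ( A + B ) + C ) = ( A + ( B + C ) ) )''"
      "[(''A'', cexpr A), (''B'', cexpr B), (''C'', cexpr C)]"])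
    (simp only: part_simps, simp_all add: parse asg_def constants_def)

lemma distr:
  "Thm (And3 (A \<^bold>\<in> CC) (B \<^bold>\<in> CC) (C \<^bold>\<in> CC) \<^bold>\<longrightarrow> A \<^bold>* (B \<^bold>+ C) \<^bold>= A \<^bold>* B \<^bold>+ A \<^bold>* C)"
  unfolding Thm_def
  by (rule core_rule[OF core_memI(5), of "[]" "[]"
      "''|- ( ( A e. CC /% B e. CC /% C e. CC ) -> ( A x. ( B + C ) ) = ( ( A x. B ) + ( A x. C ) ) )''"
      "[(''A'', cexpr A), (''B'', cexpr B), (''C'', cexpr C)]"])
    (simp only: part_simps, simp_all add: parse asg_def constants_def)

lemma i2m1:
  "Thm (im \<^bold>* im \<^bold>+ one \<^bold>= zero)"
  unfolding Thm_def
  by (rule core_rule[OF core_memI(5), of "[]" "[]"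
      "''|- ( ( _i x. _i ) + 1 ) = 0''"
      "[]"])
    (simp only: part_simps, simp_all add: parse asg_def constants_def)

lemma one_ne_zero:
  "Thm (Ne one zero)"
  unfolding Thm_def
  by (rule core_rule[OF core_memI(5), of "[]" "[]"
      "''|- 1 =/= 0''"
      "[]"])
    (simp only: part_simps, simp_all add: parse asg_def constants_def)

lemma mul_one:
  "Thm (A \<^bold>\<in> RR \<^bold>\<longrightarrow> A \<^bold>* one \<^bold>= A)"
  unfolding Thm_def
  by (rule core_rule[OF core_memI(5), of "[]" "[]"
      "''|- ( A e. RR -> ( A x. 1 ) = A )''"
      "[(''A'', cexpr A)]"])
    (simp only: part_simps, simp_all add: parse asg_def constants_def)

lemma rnegex:
  assumes "x \<notin> vars (cexpr A)"
  shows "Thm (A \<^bold>\<in> RR \<^bold>\<longrightarrow> Rex x RR (A \<^bold>+ SV x \<^bold>= zero))"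
  unfolding Thm_def
  by (rule core_rule[OF core_memI(5), of "[''x A'']" "[]"
      "''|- ( A e. RR -> E. x e. RR ( A + x ) = 0 )''"
      "[(''x'', [Vr x]), (''A'', cexpr A)]"])
    (simp only: part_simps, simp_all add: assms parse asg_def constants_def)

lemma rrecex:
  assumes "x \<notin> vars (cexpr A)"
  shows "Thm (A \<^bold>\<in> RR \<^bold>\<and> Ne A zero \<^bold>\<longrightarrow> Rex x RR (A \<^bold>* SV x \<^bold>= one))"
  unfolding Thm_def
  by (rule core_rule[OF core_memI(5), of "[''x A'']" "[]"
      "''|- ( ( A e. RR /% A =/= 0 ) -> E. x e. RR ( A x. x ) = 1 )''"
      "[(''x'', [Vr x]), (''A'', cexpr A)]"])
    (simp only: part_simps, simp_all add: assms parse asg_def constants_def)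

lemma cnre:
  assumes "x \<notin> vars (cexpr A)" and "y \<notin> vars (cexpr A)" and "x \<noteq> y"
  shows "Thm (A \<^bold>\<in> CC \<^bold>\<longrightarrow> Rex x RR (Rex y RR (A \<^bold>= SV x \<^bold>+ im \<^bold>* SV y)))"
  unfolding Thm_def
  by (rule core_rule[OF core_memI(5), of "[''x y A'']" "[]"
      "''|- ( A e. CC -> E. x e. RR E. y e. RR A = ( x + ( _i x. y ) ) )''"
      "[(''x'', [Vr x]), (''y'', [Vr y]), (''A'', cexpr A)]"])
    (simp only: part_simps, simp_all add: assms parse asg_def constants_def assms(3)[symmetric])

lemma lttri:
  "Thm (A \<^bold>\<in> RR \<^bold>\<and> B \<^bold>\<in> RR \<^bold>\<longrightarrow> (A \<^bold>< B \<^bold>\<longleftrightarrow> \<^bold>\<not> (A \<^bold>= B \<^bold>\<or> B \<^bold>< A)))"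
  unfolding Thm_def
  by (rule core_rule[OF core_memI(5), of "[]" "[]"
      "''|- ( ( A e. RR /% B e. RR ) -> ( A <RR B <-> -. ( A = B %/ B <RR A ) ) )''"
      "[(''A'', cexpr A), (''B'', cexpr B)]"])
    (simp only: part_simps, simp_all add: parse asg_def constants_def)

lemma lttrn:
  "Thm (And3 (A \<^bold>\<in> RR) (B \<^bold>\<in> RR) (C \<^bold>\<in> RR) \<^bold>\<longrightarrow> A \<^bold>< B \<^bold>\<and> B \<^bold>< C \<^bold>\<longrightarrow> A \<^bold>< C)"
  unfolding Thm_def
  by (rule core_rule[OF core_memI(5), of "[]" "[]"
      "''|- ( ( A e. RR /% B e. RR /% C e. RR ) -> ( ( A <RR B /% B <RR C ) -> A <RR C ) )''"
      "[(''A'', cexpr A), (''B'', cexpr B), (''C'', cexpr C)]"])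
    (simp only: part_simps, simp_all add: parse asg_def constants_def)

lemma ltadd:
  "Thm (And3 (A \<^bold>\<in> RR) (B \<^bold>\<in> RR) (C \<^bold>\<in> RR) \<^bold>\<longrightarrow> A \<^bold>< B \<^bold>\<longrightarrow> C \<^bold>+ A \<^bold>< C \<^bold>+ B)"
  unfolding Thm_def
  by (rule core_rule[OF core_memI(5), of "[]" "[]"
      "''|- ( ( A e. RR /% B e. RR /% C e. RR ) -> ( A <RR B -> ( C + A ) <RR ( C + B ) ) )''"
      "[(''A'', cexpr A), (''B'', cexpr B), (''C'', cexpr C)]"])
    (simp only: part_simps, simp_all add: parse asg_def constants_def)

lemma mulgt0:
  "Thm (A \<^bold>\<in> RR \<^bold>\<and> B \<^bold>\<in> RR \<^bold>\<longrightarrow> zero \<^bold>< A \<^bold>\<and> zero \<^bold>< B \<^bold>\<longrightarrow> zero \<^bold>< A \<^bold>* B)"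
  unfolding Thm_def
  by (rule core_rule[OF core_memI(5), of "[]" "[]"
      "''|- ( ( A e. RR /% B e. RR ) -> ( ( 0 <RR A /% 0 <RR B ) -> 0 <RR ( A x. B ) ) )''"
      "[(''A'', cexpr A), (''B'', cexpr B)]"])
    (simp only: part_simps, simp_all add: parse asg_def constants_def)

lemma df_ltxr:
  assumes "x \<noteq> y"
  shows "Thm (Con ''<'' \<^bold>= Cup (Opab x y (And3 (SV x \<^bold>\<in> RR) (SV y \<^bold>\<in> RR) (SV x \<^bold>< SV y)))
    (Cup (Xp (Cup RR (Sn (Con ''-oo''))) (Sn (Con ''+oo''))) (Xp (Sn (Con ''-oo'')) RR)))"
  unfolding Thm_def
  by (rule core_rule[OF core_memI(5), of "[''x y'']" "[]"
      "''|- < = ( { <. x , y >. | ( x e. RR /% y e. RR /% x <RR y ) } u. ( ( ( RR u. { -oo } ) X. { +oo } ) u. ( { -oo } X. RR ) ) )''"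
      "[(''x'', [Vr x]), (''y'', [Vr y])]"])
    (simp only: part_simps, simp_all add: assms parse asg_def constants_def assms[symmetric])

lemma df_2:
  "Thm (Con ''2'' \<^bold>= one \<^bold>+ one)"
  unfolding Thm_def
  by (rule core_rule[OF core_memI(5), of "[]" "[]"
      "''|- 2 = ( 1 + 1 )''"
      "[]"])
    (simp only: part_simps, simp_all add: parse asg_def constants_def)

lemma df_3:
  "Thm (Con ''3'' \<^bold>= Con ''2'' \<^bold>+ one)"
  unfolding Thm_def
  by (rule core_rule[OF core_memI(5), of "[]" "[]"
      "''|- 3 = ( 2 + 1 )''"
      "[]"])
    (simp only: part_simps, simp_all add: parse asg_def constants_def)

lemma df_4:
  "Thm (Con ''4'' \<^bold>= Con ''3'' \<^bold>+ one)"
  unfolding Thm_def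
  by (rule core_rule[OF core_memI(5), of "[]" "[]"
      "''|- 4 = ( 3 + 1 )''"
      "[]"])
    (simp only: part_simps, simp_all add: parse asg_def constants_def)

section \<open>Models and quantifiers\<close>

text \<open>Modus ponens is a closure condition, generalization is not. Formulas with free variables
  can thus be assumed as they stand, and the deduction theorem costs only \<open>ax1\<close> and
  \<open>ax2\<close>; \<open>ax_gen\<close> is applied to theorems alone.\<close>

definition theory_set :: "wf set \<Rightarrow> bool" where
  "theory_set S \<longleftrightarrow> {p. Thm p} \<subseteq> S \<and> (\<forall>p q. p \<in> S \<longrightarrow> (p \<^bold>\<longrightarrow> q) \<in> S \<longrightarrow> q \<in> S)"

lemma theory_mp: "\<lbrakk>theory_set S; (p \<^bold>\<longrightarrow> q) \<in> S; p \<in> S\<rbrakk> \<Longrightarrow> q \<in> S"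
  unfolding theory_set_def by blast

lemma theory_Thm: "\<lbrakk>theory_set S; Thm p\<rbrakk> \<Longrightarrow> p \<in> S"
  unfolding theory_set_def by blast

lemma theory_a1: "\<lbrakk>theory_set S; p \<in> S\<rbrakk> \<Longrightarrow> (q \<^bold>\<longrightarrow> p) \<in> S"
  by (meson ax1 theory_Thm theory_mp)

lemma theory_a2: "\<lbrakk>theory_set S; (p \<^bold>\<longrightarrow> q \<^bold>\<longrightarrow> r) \<in> S; (p \<^bold>\<longrightarrow> q) \<in> S\<rbrakk> \<Longrightarrow> (p \<^bold>\<longrightarrow> r) \<in> S"
  by (meson ax2 theory_Thm theory_mp)

lemma theory_a3: "\<lbrakk>theory_set S; (\<^bold>\<not> p \<^bold>\<longrightarrow> \<^bold>\<not> q) \<in> S\<rbrakk> \<Longrightarrow> (q \<^bold>\<longrightarrow> p) \<in> S"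
  by (meson ax3 theory_Thm theory_mp)

lemma theory_id: "theory_set S \<Longrightarrow> (p \<^bold>\<longrightarrow> p) \<in> S"
  using theory_a2[of S p "p \<^bold>\<longrightarrow> p" p] ax1 theory_Thm by blast

lemma theory_trans: "\<lbrakk>theory_set S; (p \<^bold>\<longrightarrow> q) \<in> S; (q \<^bold>\<longrightarrow> r) \<in> S\<rbrakk> \<Longrightarrow> (p \<^bold>\<longrightarrow> r) \<in> S"
  by (meson theory_a1 theory_a2)

lemma theory_absurd: "theory_set S \<Longrightarrow> (\<^bold>\<not> p \<^bold>\<longrightarrow> p \<^bold>\<longrightarrow> q) \<in> S"
  by (meson ax1 ax3 theory_Thm theory_trans)

lemma theory_notnotD: "theory_set S \<Longrightarrow> (\<^bold>\<not> \<^bold>\<not> p \<^bold>\<longrightarrow> p) \<in> S"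
proof -
  assume S: "theory_set S"
  have "(\<^bold>\<not> \<^bold>\<not> p \<^bold>\<longrightarrow> \<^bold>\<not> p \<^bold>\<longrightarrow> \<^bold>\<not> \<^bold>\<not> \<^bold>\<not> p) \<in> S" by (rule theory_absurd[OF S])
  moreover have "((\<^bold>\<not> p \<^bold>\<longrightarrow> \<^bold>\<not> \<^bold>\<not> \<^bold>\<not> p) \<^bold>\<longrightarrow> \<^bold>\<not> \<^bold>\<not> p \<^bold>\<longrightarrow> p) \<in> S"
    by (meson S ax3 theory_Thm)
  ultimately have "(\<^bold>\<not> \<^bold>\<not> p \<^bold>\<longrightarrow> \<^bold>\<not> \<^bold>\<not> p \<^bold>\<longrightarrow> p) \<in> S" by (rule theory_trans[OF S])
  then show ?thesis by (meson S theory_a2 theory_id)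
qed

lemma theory_notnotI: "theory_set S \<Longrightarrow> (p \<^bold>\<longrightarrow> \<^bold>\<not> \<^bold>\<not> p) \<in> S"
  by (simp add: theory_a3 theory_notnotD)

lemma theory_contrapos: "\<lbrakk>theory_set S; (p \<^bold>\<longrightarrow> q) \<in> S\<rbrakk> \<Longrightarrow> (\<^bold>\<not> q \<^bold>\<longrightarrow> \<^bold>\<not> p) \<in> S"
  by (meson theory_a3 theory_notnotD theory_notnotI theory_trans)

text \<open>From the negation of \<open>p\<close> follow \<open>p\<close> and then, by
  \<open>theory_absurd\<close>, anything at all. Taking the negation of the theorem
  \<open>p --> p\<close> for it and contraposing gives \<open>p\<close>.\<close>

lemma theory_clavius: "\<lbrakk>theory_set S; (\<^bold>\<not> p \<^bold>\<longrightarrow> p) \<in> S\<rbrakk> \<Longrightarrow> p \<in> S"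
proof -
  assume S: "theory_set S" and p: "(\<^bold>\<not> p \<^bold>\<longrightarrow> p) \<in> S"
  have "(\<^bold>\<not> p \<^bold>\<longrightarrow> \<^bold>\<not> (p \<^bold>\<longrightarrow> p)) \<in> S"
    using theory_a2[OF S theory_absurd[OF S] p] .
  then show ?thesis by (meson S theory_a3 theory_id theory_mp)
qed

lemma theory_cases: "\<lbrakk>theory_set S; (p \<^bold>\<longrightarrow> q) \<in> S; (\<^bold>\<not> p \<^bold>\<longrightarrow> q) \<in> S\<rbrakk> \<Longrightarrow> q \<in> S"
  by (meson theory_clavius theory_contrapos theory_trans)

text \<open>The deduction theorem: these are the consequences of \<open>S\<close> together with
  \<open>q\<close>.\<close>

lemma theory_extend: "theory_set S \<Longrightarrow> theory_set {r. (q \<^bold>\<longrightarrow> r) \<in> S}"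
  unfolding theory_set_def[of "{r. (q \<^bold>\<longrightarrow> r) \<in> S}"]
  by (auto intro: theory_a1 theory_a2 theory_Thm)

text \<open>A Boolean valuation that makes all theorems true. It treats quantified formulas as
  atoms; whatever is known of them comes from theorems about them.\<close>

definition model :: "wf set \<Rightarrow> bool" where
  "model M \<longleftrightarrow> {p. Thm p} \<subseteq> M
     \<and> (\<forall>p. (\<^bold>\<not> p) \<in> M \<longleftrightarrow> p \<notin> M)
     \<and> (\<forall>p q. (p \<^bold>\<longrightarrow> q) \<in> M \<longleftrightarrow> (p \<in> M \<longrightarrow> q \<in> M))"

text \<open>A theory maximal among those avoiding a formula is a model.\<close>

lemma Thm_if_models:
  assumes "\<And>M. model M \<Longrightarrow> p \<in> M"
  shows "Thm p"
proof (rule ccontr)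
  assume np: "\<not> Thm p"
  let ?A = "{S. theory_set S \<and> p \<notin> S}"
  have base: "{q. Thm q} \<in> ?A"
    using np ax_mp unfolding theory_set_def by blast
  have "\<exists>M\<in>?A. \<forall>S\<in>?A. M \<subseteq> S \<longrightarrow> S = M"
  proof (rule subset_Zorn_nonempty)
    show "?A \<noteq> {}" using base by blast
  next
    fix K assume K: "K \<noteq> {}" "subset.chain ?A K"
    have "theory_set (\<Union>K)"
      unfolding theory_set_def
    proof (intro conjI allI impI)
      show "{q. Thm q} \<subseteq> \<Union>K"
        using K unfolding subset_chain_def theory_set_def by blast
    next
      fix q r assume "q \<in> \<Union>K" "(q \<^bold>\<longrightarrow> r) \<in> \<Union>K"
      then obtain S S' where S: "S \<in> K" "S' \<in> K" "q \<in> S" "(q \<^bold>\<longrightarrow> r) \<in> S'" by blast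
      then have "S \<subseteq> S' \<or> S' \<subseteq> S" using K unfolding subset_chain_def by blast
      then obtain U where "U \<in> K" "q \<in> U" "(q \<^bold>\<longrightarrow> r) \<in> U" using S by blast
      moreover from this have "theory_set U" using K unfolding subset_chain_def by blast
      ultimately show "r \<in> \<Union>K" using theory_mp by blast
    qed
    then show "\<Union>K \<in> ?A" using K unfolding subset_chain_def by blast
  qed
  then obtain M where M: "theory_set M" "p \<notin> M"
    and mx: "\<And>S. \<lbrakk>theory_set S; p \<notin> S; M \<subseteq> S\<rbrakk> \<Longrightarrow> S = M" by blast
  \<comment> \<open>Otherwise the consequences of \<open>M\<close> and \<open>q\<close> would form a
    larger theory without \<open>p\<close>.\<close>
  have ext: "(q \<^bold>\<longrightarrow> p) \<in> M" if "q \<notin> M" for q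
  proof (rule ccontr)
    assume "(q \<^bold>\<longrightarrow> p) \<notin> M"
    then have "{r. (q \<^bold>\<longrightarrow> r) \<in> M} = M"
      using M by (intro mx theory_extend) (auto intro: theory_a1)
    then show False using theory_id[OF M(1), of q] that by blast
  qed
  \<comment> \<open>\<open>M\<close> cannot contain both \<open>q\<close> and its negation, as
    \<open>p\<close> would follow, nor miss both, as each of them would then imply
    \<open>p\<close>.\<close>
  have neg: "(\<^bold>\<not> q) \<in> M \<longleftrightarrow> q \<notin> M" for q
    by (meson M ext theory_absurd theory_cases theory_mp)
  have "model M"
    unfolding model_def
  proof (intro conjI allI)
    show "{q. Thm q} \<subseteq> M" using M(1) by (simp add: theory_set_def)
    show "(\<^bold>\<not> q) \<in> M \<longleftrightarrow> q \<notin> M" for q by (rule neg)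
    show "(q \<^bold>\<longrightarrow> r) \<in> M \<longleftrightarrow> (q \<in> M \<longrightarrow> r \<in> M)" for q r
      by (meson M(1) neg theory_a1 theory_absurd theory_mp)
  qed
  then show False using assms M(2) by blast
qed

section \<open>Truth of the connectives in a model\<close>

lemma model_Thm: "\<lbrakk>Thm p; model M\<rbrakk> \<Longrightarrow> p \<in> M"
  unfolding model_def by blast

lemma model_Neg [simp]: "model M \<Longrightarrow> (\<^bold>\<not> p) \<in> M \<longleftrightarrow> p \<notin> M"
  unfolding model_def by blast

lemma model_Imp [simp]: "model M \<Longrightarrow> (p \<^bold>\<longrightarrow> q) \<in> M \<longleftrightarrow> (p \<in> M \<longrightarrow> q \<in> M)"
  unfolding model_def by blast

lemma model_Iff [simp]: "model M \<Longrightarrow> (p \<^bold>\<longleftrightarrow> q) \<in> M \<longleftrightarrow> (p \<in> M \<longleftrightarrow> q \<in> M)"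
  using model_Thm[OF df_bi[of p q], of M] by auto

lemma model_Or [simp]: "model M \<Longrightarrow> (p \<^bold>\<or> q) \<in> M \<longleftrightarrow> p \<in> M \<or> q \<in> M"
  using model_Thm[OF df_or[of p q], of M] by auto

lemma model_And [simp]: "model M \<Longrightarrow> (p \<^bold>\<and> q) \<in> M \<longleftrightarrow> p \<in> M \<and> q \<in> M"
  using model_Thm[OF df_an[of p q], of M] by auto

lemma model_And3 [simp]: "model M \<Longrightarrow> And3 p q r \<in> M \<longleftrightarrow> p \<in> M \<and> q \<in> M \<and> r \<in> M"
  using model_Thm[OF df_3an[of p q r], of M] by auto

lemma model_Ne [simp]: "model M \<Longrightarrow> Ne A B \<in> M \<longleftrightarrow> (A \<^bold>= B) \<notin> M"
  using model_Thm[OF df_ne[of A B], of M] by auto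

lemma model_Rex: "model M \<Longrightarrow> Rex x A p \<in> M \<longleftrightarrow> Ex x (SV x \<^bold>\<in> A \<^bold>\<and> p) \<in> M"
  using model_Thm[OF df_rex[of x A p], of M] by auto

lemma model_Ex: "model M \<Longrightarrow> Ex x p \<in> M \<longleftrightarrow> All x (\<^bold>\<not> p) \<notin> M"
  using model_Thm[OF df_ex[of x p], of M] by auto

lemma Thm_allI:
  assumes "Thm (g \<^bold>\<longrightarrow> p)" "x \<notin> vars (wexpr g)"
  shows "Thm (g \<^bold>\<longrightarrow> All x p)"
proof (rule Thm_if_models)
  fix M assume M: "model M"
  show "(g \<^bold>\<longrightarrow> All x p) \<in> M"
    using model_Thm[OF ax5[OF assms(2)] M] model_Thm[OF ax4 M, of x g p]
      model_Thm[OF ax_gen[OF assms(1), of x] M] M by simp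
qed

text \<open>The contrapositive of \<open>Thm_allI\<close>. Every elimination of a witness rests on
  this rule, hence the demand that \<open>q\<close> does not mention it.\<close>

lemma Thm_exE:
  assumes "Thm (p \<^bold>\<longrightarrow> q)" "x \<notin> vars (wexpr q)"
  shows "Thm (Ex x p \<^bold>\<longrightarrow> q)"
proof (rule Thm_if_models)
  fix M assume M: "model M"
  have "Thm (\<^bold>\<not> q \<^bold>\<longrightarrow> \<^bold>\<not> p)"
    by (rule Thm_if_models) (use model_Thm[OF assms(1)] in auto)
  then have "Thm (\<^bold>\<not> q \<^bold>\<longrightarrow> All x (\<^bold>\<not> p))" by (rule Thm_allI) (simp add: assms(2))
  from model_Thm[OF this M] show "(Ex x p \<^bold>\<longrightarrow> q) \<in> M" using M by (auto simp: model_Ex)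
qed

lemma fresh_var:
  assumes "finite (S :: string set)"
  obtains x where "x \<notin> S"
  using assms ex_new_if_finite infinite_UNIV_listI by blast

lemma ex_eq: "Thm (Ex x (SV x \<^bold>= SV y))"
  by (rule Thm_if_models) (use model_Thm[OF ax6[of x y]] in \<open>auto simp: model_Ex\<close>)

text \<open>Two copies of \<open>y = x\<close> give \<open>x = x\<close> by \<open>ax7\<close>; the
  fresh \<open>y\<close> is removed because something equal to \<open>x\<close> exists.\<close>

lemma setvar_refl: "Thm (SV x \<^bold>= SV x)"
proof -
  obtain y where "y \<notin> {x}" by (rule fresh_var[of "{x}"]) simp
  then have y: "y \<noteq> x" by simp
  have "Thm (SV y \<^bold>= SV x \<^bold>\<longrightarrow> SV x \<^bold>= SV x)"
    by (rule Thm_if_models) (use model_Thm[OF ax7[of y x x]] in auto)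
  then have "Thm (Ex y (SV y \<^bold>= SV x) \<^bold>\<longrightarrow> SV x \<^bold>= SV x)"
    by (rule Thm_exE) (use y in simp)
  then show ?thesis using ex_eq ax_mp by blast
qed

text \<open>Specialization is not among the axioms. With a fresh \<open>y\<close> equal to
  \<open>x\<close>, \<open>ax5\<close> and \<open>ax12\<close> turn \<open>p\<close> into
  \<open>All x (x = y --> p)\<close>; if \<open>p\<close> failed for all \<open>x\<close>, then so
  would \<open>x = y\<close>, against \<open>ax6\<close>.\<close>

lemma Thm_exI: "Thm (p \<^bold>\<longrightarrow> Ex x p)"
proof -
  obtain y where "y \<notin> insert x (vars (wexpr p))"
    by (rule fresh_var[of "insert x (vars (wexpr p))"]) simp
  then have y: "y \<noteq> x" "y \<notin> vars (wexpr p)" by simp_all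
  have "Thm (SV y \<^bold>= SV x \<^bold>\<longrightarrow> p \<^bold>\<longrightarrow> Ex x p)"
  proof (rule Thm_if_models)
    fix M assume M: "model M"
    have "Thm ((SV x \<^bold>= SV y \<^bold>\<longrightarrow> p) \<^bold>\<longrightarrow> (\<^bold>\<not> p \<^bold>\<longrightarrow> \<^bold>\<not> SV x \<^bold>= SV y))"
      by (rule Thm_if_models) auto
    from ax_gen[OF this, of x]
    have "All x (SV x \<^bold>= SV y \<^bold>\<longrightarrow> p) \<in> M \<Longrightarrow> All x (\<^bold>\<not> p) \<in> M \<Longrightarrow> All x (\<^bold>\<not> SV x \<^bold>= SV y) \<in> M"
      using model_Thm[OF ax4 M, of x "SV x \<^bold>= SV y \<^bold>\<longrightarrow> p" "\<^bold>\<not> p \<^bold>\<longrightarrow> \<^bold>\<not> SV x \<^bold>= SV y"]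
        model_Thm[OF ax4 M, of x "\<^bold>\<not> p" "\<^bold>\<not> SV x \<^bold>= SV y"] model_Thm[OF _ M] M by simp
    moreover have "(SV y \<^bold>= SV x) \<in> M \<Longrightarrow> (SV x \<^bold>= SV y) \<in> M"
      using model_Thm[OF ax7[of y x y] M] model_Thm[OF setvar_refl[of y] M] M by simp
    ultimately show "(SV y \<^bold>= SV x \<^bold>\<longrightarrow> p \<^bold>\<longrightarrow> Ex x p) \<in> M"
      using model_Thm[OF ax12[of x y p] M] model_Thm[OF ax5[of y p] M]
        model_Thm[OF ax6[of x y] M] M y by (auto simp: model_Ex)
  qed
  then have "Thm (Ex y (SV y \<^bold>= SV x) \<^bold>\<longrightarrow> p \<^bold>\<longrightarrow> Ex x p)"
    by (rule Thm_exE) (use y in simp)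
  then show ?thesis using ex_eq ax_mp by blast
qed

lemma Thm_all_mono:
  assumes "Thm (g \<^bold>\<longrightarrow> p \<^bold>\<longrightarrow> q)" "x \<notin> vars (wexpr g)"
  shows "Thm (g \<^bold>\<longrightarrow> All x p \<^bold>\<longrightarrow> All x q)"
  by (rule Thm_if_models)
    (use model_Thm[OF Thm_allI[OF assms]] model_Thm[OF ax4[of x p q]] in auto)

lemma Thm_ex_mono:
  assumes "Thm (g \<^bold>\<longrightarrow> p \<^bold>\<longrightarrow> q)" "x \<notin> vars (wexpr g)"
  shows "Thm (g \<^bold>\<longrightarrow> Ex x p \<^bold>\<longrightarrow> Ex x q)"
proof -
  have "Thm (g \<^bold>\<longrightarrow> \<^bold>\<not> q \<^bold>\<longrightarrow> \<^bold>\<not> p)"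
    by (rule Thm_if_models) (use model_Thm[OF assms(1)] in auto)
  from Thm_all_mono[OF this assms(2)] show ?thesis
    by (intro Thm_if_models) (auto dest: model_Thm simp: model_Ex)
qed

lemma Thm_ex_cong:
  assumes "Thm (g \<^bold>\<longrightarrow> p \<^bold>\<longleftrightarrow> q)" "x \<notin> vars (wexpr g)"
  shows "Thm (g \<^bold>\<longrightarrow> Ex x p \<^bold>\<longleftrightarrow> Ex x q)"
proof -
  have "Thm (g \<^bold>\<longrightarrow> p \<^bold>\<longrightarrow> q)" "Thm (g \<^bold>\<longrightarrow> q \<^bold>\<longrightarrow> p)"
    by (rule Thm_if_models, use model_Thm[OF assms(1)] in auto)+
  from this[THEN Thm_ex_mono[OF _ assms(2)]] show ?thesis
    by (intro Thm_if_models) (auto dest: model_Thm)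
qed

text \<open>\<open>Thm_exI\<close> for the negation of \<open>p\<close>, contraposed;
  \<open>df_ex\<close> puts a double negation under the quantifier, which is inserted by means of
  \<open>ax4\<close>.\<close>

lemma Thm_allE: "Thm (All x p \<^bold>\<longrightarrow> p)"
proof -
  have "Thm (All x p \<^bold>\<longrightarrow> All x (\<^bold>\<not> \<^bold>\<not> p))"
    by (rule ax_mp[OF ax_gen ax4]) (rule Thm_if_models, simp)
  from model_Thm[OF this] show ?thesis
    by (intro Thm_if_models) (use model_Thm[OF Thm_exI[of "\<^bold>\<not> p" x]] in \<open>auto simp: model_Ex\<close>)
qed

section \<open>Extensional equality and membership of classes\<close>

lemma df_cleq:
  assumes "x \<notin> vars (cexpr A)" "x \<notin> vars (cexpr B)"
  shows "Thm (A \<^bold>= B \<^bold>\<longleftrightarrow> All x (SV x \<^bold>\<in> A \<^bold>\<longleftrightarrow> SV x \<^bold>\<in> B))"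
proof -
  obtain y where y: "y \<notin> {x}" by (rule fresh_var[of "{x}"]) simp
  obtain z where z: "z \<notin> {x, y}" by (rule fresh_var[of "{x, y}"]) simp
  show ?thesis using df_cleq_distinct[OF assms, of y z] y z by auto
qed

lemma Thm_eqI:
  assumes "Thm (g \<^bold>\<longrightarrow> SV x \<^bold>\<in> A \<^bold>\<longleftrightarrow> SV x \<^bold>\<in> B)"
    and "x \<notin> vars (wexpr g)" "x \<notin> vars (cexpr A)" "x \<notin> vars (cexpr B)"
  shows "Thm (g \<^bold>\<longrightarrow> A \<^bold>= B)"
  by (rule Thm_if_models)
    (use model_Thm[OF Thm_allI[OF assms(1,2)]] model_Thm[OF df_cleq[OF assms(3,4)]] in auto)

lemma Thm_eqD:
  assumes "x \<notin> vars (cexpr A)" "x \<notin> vars (cexpr B)"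
  shows "Thm (A \<^bold>= B \<^bold>\<longrightarrow> SV x \<^bold>\<in> A \<^bold>\<longleftrightarrow> SV x \<^bold>\<in> B)"
  by (rule Thm_if_models)
    (use model_Thm[OF df_cleq[OF assms]] model_Thm[OF Thm_allE[of x]] in auto)

lemma fresh_for:
  obtains x where "x \<notin> vars (cexpr A)" "x \<notin> vars (cexpr B)" "x \<notin> vars (cexpr C)"
    "x \<notin> vars (cexpr D)"
proof -
  obtain x where "x \<notin> vars (cexpr A) \<union> vars (cexpr B) \<union> vars (cexpr C) \<union> vars (cexpr D)"
    by (rule fresh_var[of "vars (cexpr A) \<union> vars (cexpr B) \<union> vars (cexpr C) \<union> vars (cexpr D)"]) simp
  then show ?thesis using that by blast
qed

lemma Thm_eq_refl: "Thm (A \<^bold>= A)"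
proof -
  obtain x where x: "x \<notin> vars (cexpr A)" by (rule fresh_for)
  have "Thm (All x (SV x \<^bold>\<in> A \<^bold>\<longleftrightarrow> SV x \<^bold>\<in> A))" by (rule ax_gen) (rule Thm_if_models, simp)
  from model_Thm[OF this] show ?thesis
    by (intro Thm_if_models)
      (use model_Thm[OF df_cleq[OF x x]] in auto)
qed

lemma Thm_eq_sym: "Thm (A \<^bold>= B \<^bold>\<longrightarrow> B \<^bold>= A)"
proof -
  obtain x where x: "x \<notin> vars (cexpr A)" "x \<notin> vars (cexpr B)" by (rule fresh_for)
  have "Thm (A \<^bold>= B \<^bold>\<longrightarrow> SV x \<^bold>\<in> B \<^bold>\<longleftrightarrow> SV x \<^bold>\<in> A)"
    by (rule Thm_if_models) (use model_Thm[OF Thm_eqD[OF x]] in auto)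
  then show ?thesis by (rule Thm_eqI) (use x in simp_all)
qed

lemma Thm_eq_trans: "Thm (A \<^bold>= B \<^bold>\<and> B \<^bold>= C \<^bold>\<longrightarrow> A \<^bold>= C)"
proof -
  obtain x where x: "x \<notin> vars (cexpr A)" "x \<notin> vars (cexpr B)" "x \<notin> vars (cexpr C)"
    by (rule fresh_for)
  have "Thm (A \<^bold>= B \<^bold>\<and> B \<^bold>= C \<^bold>\<longrightarrow> SV x \<^bold>\<in> A \<^bold>\<longleftrightarrow> SV x \<^bold>\<in> C)"
    by (rule Thm_if_models)
      (use model_Thm[OF Thm_eqD[OF x(1,2)]] model_Thm[OF Thm_eqD[OF x(2,3)]] in auto)
  then show ?thesis by (rule Thm_eqI) (use x in simp_all)
qed

text \<open>By \<open>df_clel\<close>, \<open>A\<close> is a member only through a set variable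
  equal to it, and that variable equals \<open>B\<close> as well.\<close>

lemma mem_cong_left: "Thm (A \<^bold>= B \<^bold>\<longrightarrow> A \<^bold>\<in> C \<^bold>\<longrightarrow> B \<^bold>\<in> C)"
proof -
  obtain x where x: "x \<notin> vars (cexpr A)" "x \<notin> vars (cexpr B)" "x \<notin> vars (cexpr C)"
    by (rule fresh_for)
  have "Thm (A \<^bold>= B \<^bold>\<longrightarrow> (SV x \<^bold>= A \<^bold>\<and> SV x \<^bold>\<in> C) \<^bold>\<longrightarrow> (SV x \<^bold>= B \<^bold>\<and> SV x \<^bold>\<in> C))"
    by (rule Thm_if_models) (use model_Thm[OF Thm_eq_trans[of "SV x" A B]] in auto)
  then have "Thm (A \<^bold>= B \<^bold>\<longrightarrow> Ex x (SV x \<^bold>= A \<^bold>\<and> SV x \<^bold>\<in> C) \<^bold>\<longrightarrow> Ex x (SV x \<^bold>= B \<^bold>\<and> SV x \<^bold>\<in> C))"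
    by (rule Thm_ex_mono) (use x in simp)
  from model_Thm[OF this] show ?thesis
    by (intro Thm_if_models)
      (use model_Thm[OF df_clel[OF x(1,3)]] model_Thm[OF df_clel[OF x(2,3)]] in auto)
qed

lemma mem_cong_right: "Thm (A \<^bold>= B \<^bold>\<longrightarrow> C \<^bold>\<in> A \<^bold>\<longrightarrow> C \<^bold>\<in> B)"
proof -
  obtain x where x: "x \<notin> vars (cexpr A)" "x \<notin> vars (cexpr B)" "x \<notin> vars (cexpr C)"
    by (rule fresh_for)
  have "Thm (A \<^bold>= B \<^bold>\<longrightarrow> (SV x \<^bold>= C \<^bold>\<and> SV x \<^bold>\<in> A) \<^bold>\<longrightarrow> (SV x \<^bold>= C \<^bold>\<and> SV x \<^bold>\<in> B))"
    by (rule Thm_if_models) (use model_Thm[OF Thm_eqD[OF x(1,2)]] in auto)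
  then have "Thm (A \<^bold>= B \<^bold>\<longrightarrow> Ex x (SV x \<^bold>= C \<^bold>\<and> SV x \<^bold>\<in> A) \<^bold>\<longrightarrow> Ex x (SV x \<^bold>= C \<^bold>\<and> SV x \<^bold>\<in> B))"
    by (rule Thm_ex_mono) (use x in simp)
  from model_Thm[OF this] show ?thesis
    by (intro Thm_if_models)
      (use model_Thm[OF df_clel[OF x(3,1)]] model_Thm[OF df_clel[OF x(3,2)]] in auto)
qed

text \<open>With the bound variable itself as the element, the substitution in df-sb is governed by
  \<open>x = x\<close> and disappears, so comprehension can be applied without renaming.\<close>

lemma abid: "Thm (SV x \<^bold>\<in> Ab x p \<^bold>\<longleftrightarrow> p)"
  by (rule Thm_if_models)
    (use model_Thm[OF df_clab[of x x p]] model_Thm[OF df_sb[of x x p]] model_Thm[OF setvar_refl[of x]]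
      model_Thm[OF Thm_exI[of "SV x \<^bold>= SV x \<^bold>\<and> p" x]] in auto)

text \<open>df-sb expresses substitution by an implication and an existential. The equivalence
  passes through the first directly, since \<open>x\<close> is free there, and through the second by
  \<open>Thm_ex_cong\<close>.\<close>

lemma Ab_cong:
  assumes "Thm (g \<^bold>\<longrightarrow> p \<^bold>\<longleftrightarrow> q)" "x \<notin> vars (wexpr g)"
  shows "Thm (g \<^bold>\<longrightarrow> Ab x p \<^bold>= Ab x q)"
proof -
  obtain y where y: "y \<notin> insert x (vars (wexpr g) \<union> vars (wexpr p) \<union> vars (wexpr q))"
    by (rule fresh_var[of "insert x (vars (wexpr g) \<union> vars (wexpr p) \<union> vars (wexpr q))"]) simp
  have "Thm (g \<^bold>\<longrightarrow> (SV x \<^bold>= SV y \<^bold>\<and> p) \<^bold>\<longleftrightarrow> (SV x \<^bold>= SV y \<^bold>\<and> q))"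
    by (rule Thm_if_models) (use model_Thm[OF assms(1)] in auto)
  then have ex: "Thm (g \<^bold>\<longrightarrow> Ex x (SV x \<^bold>= SV y \<^bold>\<and> p) \<^bold>\<longleftrightarrow> Ex x (SV x \<^bold>= SV y \<^bold>\<and> q))"
    by (rule Thm_ex_cong) (rule assms(2))
  have "Thm (g \<^bold>\<longrightarrow> SV y \<^bold>\<in> Ab x p \<^bold>\<longleftrightarrow> SV y \<^bold>\<in> Ab x q)"
    by (rule Thm_if_models)
      (use model_Thm[OF df_clab[of y x p]] model_Thm[OF df_sb[of y x p]]
        model_Thm[OF df_clab[of y x q]] model_Thm[OF df_sb[of y x q]]
        model_Thm[OF ex] model_Thm[OF assms(1)] in auto)
  then show ?thesis by (rule Thm_eqI) (use y in simp_all)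
qed

section \<open>Congruence of class terms\<close>

lemma model_eq_sym: "\<lbrakk>model M; (A \<^bold>= B) \<in> M\<rbrakk> \<Longrightarrow> (B \<^bold>= A) \<in> M"
  using model_Thm[OF Thm_eq_sym[of A B], of M] by simp

lemma model_eq_trans: "\<lbrakk>model M; (A \<^bold>= B) \<in> M; (B \<^bold>= C) \<in> M\<rbrakk> \<Longrightarrow> (A \<^bold>= C) \<in> M"
  using model_Thm[OF Thm_eq_trans[of A B C], of M] by simp

lemma model_mem_cong: "\<lbrakk>model M; (A \<^bold>= B) \<in> M; (A \<^bold>\<in> C) \<in> M\<rbrakk> \<Longrightarrow> (B \<^bold>\<in> C) \<in> M"
  using model_Thm[OF mem_cong_left[of A B C], of M] by simp

lemma model_mem_eq: "\<lbrakk>model M; (A \<^bold>= B) \<in> M\<rbrakk> \<Longrightarrow> (C \<^bold>\<in> A) \<in> M \<longleftrightarrow> (C \<^bold>\<in> B) \<in> M"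
  using model_Thm[OF mem_cong_right[of A B C], of M] model_Thm[OF mem_cong_right[of B A C], of M]
    model_eq_sym[of M A B] by auto

lemma model_eq_cong:
  "\<lbrakk>model M; (A \<^bold>= B) \<in> M; (C \<^bold>= D) \<in> M\<rbrakk> \<Longrightarrow> (A \<^bold>= C) \<in> M \<longleftrightarrow> (B \<^bold>= D) \<in> M"
  using model_eq_sym[of M] model_eq_trans[of M] by blast

lemma Sn_cong: "Thm (A \<^bold>= B \<^bold>\<longrightarrow> Sn A \<^bold>= Sn B)"
proof -
  obtain x where x: "x \<notin> vars (cexpr A)" "x \<notin> vars (cexpr B)" by (rule fresh_for)
  have "Thm (A \<^bold>= B \<^bold>\<longrightarrow> SV x \<^bold>= A \<^bold>\<longleftrightarrow> SV x \<^bold>= B)"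
  proof (rule Thm_if_models)
    fix M assume M: "model M"
    show "(A \<^bold>= B \<^bold>\<longrightarrow> SV x \<^bold>= A \<^bold>\<longleftrightarrow> SV x \<^bold>= B) \<in> M"
      using model_eq_cong[OF M model_Thm[OF Thm_eq_refl[of "SV x"] M], of A B] M by simp
  qed
  then have "Thm (A \<^bold>= B \<^bold>\<longrightarrow> Ab x (SV x \<^bold>= A) \<^bold>= Ab x (SV x \<^bold>= B))"
    by (rule Ab_cong) (use x in simp)
  from model_Thm[OF this] show ?thesis
    by (intro Thm_if_models)
      (use model_eq_cong[OF _ model_Thm[OF df_sn[OF x(1)]] model_Thm[OF df_sn[OF x(2)]]] in auto)
qed

lemma Cup_cong: "Thm (A \<^bold>= C \<^bold>\<and> B \<^bold>= D \<^bold>\<longrightarrow> Cup A B \<^bold>= Cup C D)"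
proof -
  obtain x where x: "x \<notin> vars (cexpr A)" "x \<notin> vars (cexpr B)" "x \<notin> vars (cexpr C)"
    "x \<notin> vars (cexpr D)" by (rule fresh_for)
  have "Thm (A \<^bold>= C \<^bold>\<and> B \<^bold>= D \<^bold>\<longrightarrow> (SV x \<^bold>\<in> A \<^bold>\<or> SV x \<^bold>\<in> B) \<^bold>\<longleftrightarrow> (SV x \<^bold>\<in> C \<^bold>\<or> SV x \<^bold>\<in> D))"
    by (rule Thm_if_models) (auto simp: model_mem_eq)
  then have "Thm (A \<^bold>= C \<^bold>\<and> B \<^bold>= D \<^bold>\<longrightarrow> Ab x (SV x \<^bold>\<in> A \<^bold>\<or> SV x \<^bold>\<in> B) \<^bold>= Ab x (SV x \<^bold>\<in> C \<^bold>\<or> SV x \<^bold>\<in> D))"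
    by (rule Ab_cong) (use x in simp)
  from model_Thm[OF this] show ?thesis
    by (intro Thm_if_models)
      (use model_eq_cong[OF _ model_Thm[OF df_un[OF x(1,2)]] model_Thm[OF df_un[OF x(3,4)]]] in auto)
qed

lemma Pr_cong: "Thm (A \<^bold>= C \<^bold>\<and> B \<^bold>= D \<^bold>\<longrightarrow> Pr A B \<^bold>= Pr C D)"
proof (rule Thm_if_models)
  fix M assume M: "model M"
  show "(A \<^bold>= C \<^bold>\<and> B \<^bold>= D \<^bold>\<longrightarrow> Pr A B \<^bold>= Pr C D) \<in> M"
    using model_Thm[OF Sn_cong[of A C] M] model_Thm[OF Sn_cong[of B D] M]
      model_Thm[OF Cup_cong[of "Sn A" "Sn C" "Sn B" "Sn D"] M]
      model_eq_cong[OF M model_Thm[OF df_pr[of A B] M] model_Thm[OF df_pr[of C D] M]] M by simp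
qed

lemma Op_cong: "Thm (A \<^bold>= C \<^bold>\<and> B \<^bold>= D \<^bold>\<longrightarrow> Op A B \<^bold>= Op C D)"
proof -
  obtain x where x: "x \<notin> vars (cexpr A)" "x \<notin> vars (cexpr B)" "x \<notin> vars (cexpr C)"
    "x \<notin> vars (cexpr D)" by (rule fresh_for)
  let ?p = "\<lambda>A B. And3 (A \<^bold>\<in> Con ''_V'') (B \<^bold>\<in> Con ''_V'') (SV x \<^bold>\<in> Pr (Sn A) (Pr A B))"
  have "Thm (A \<^bold>= C \<^bold>\<and> B \<^bold>= D \<^bold>\<longrightarrow> ?p A B \<^bold>\<longleftrightarrow> ?p C D)"
  proof (rule Thm_if_models)
    fix M assume M: "model M"
    have V: "(A \<^bold>\<in> Con ''_V'') \<in> M \<longleftrightarrow> (C \<^bold>\<in> Con ''_V'') \<in> M" if "(A \<^bold>= C) \<in> M" for A C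
      using model_mem_cong[OF M] that model_eq_sym[OF M that] by blast
    have "(SV x \<^bold>\<in> Pr (Sn A) (Pr A B)) \<in> M \<longleftrightarrow> (SV x \<^bold>\<in> Pr (Sn C) (Pr C D)) \<in> M"
      if "(A \<^bold>= C) \<in> M" "(B \<^bold>= D) \<in> M"
      by (rule model_mem_eq[OF M])
        (use that M model_Thm[OF Sn_cong[of A C] M] model_Thm[OF Pr_cong[of A C B D] M]
          model_Thm[OF Pr_cong[of "Sn A" "Sn C" "Pr A B" "Pr C D"] M] in simp)
    then show "(A \<^bold>= C \<^bold>\<and> B \<^bold>= D \<^bold>\<longrightarrow> ?p A B \<^bold>\<longleftrightarrow> ?p C D) \<in> M"
      using V[of A C] V[of B D] M by auto
  qed
  then have "Thm (A \<^bold>= C \<^bold>\<and> B \<^bold>= D \<^bold>\<longrightarrow> Ab x (?p A B) \<^bold>= Ab x (?p C D))"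
    by (rule Ab_cong) (use x in simp)
  from model_Thm[OF this] show ?thesis
    by (intro Thm_if_models)
      (use model_eq_cong[OF _ model_Thm[OF df_op[OF x(1,2)]] model_Thm[OF df_op[OF x(3,4)]]] in auto)
qed

lemma Br_cong: "Thm (A \<^bold>= C \<^bold>\<and> B \<^bold>= D \<^bold>\<longrightarrow> Br A R B \<^bold>\<longrightarrow> Br C R D)"
proof (rule Thm_if_models)
  fix M assume M: "model M"
  show "(A \<^bold>= C \<^bold>\<and> B \<^bold>= D \<^bold>\<longrightarrow> Br A R B \<^bold>\<longrightarrow> Br C R D) \<in> M"
    using model_Thm[OF df_br[of A R B] M] model_Thm[OF df_br[of C R D] M]
      model_Thm[OF Op_cong[of A C B D] M] model_mem_cong[OF M, of "Op A B" "Op C D" R] M by simp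
qed

lemma model_Br_cong:
  "\<lbrakk>model M; (A \<^bold>= C) \<in> M; (B \<^bold>= D) \<in> M\<rbrakk> \<Longrightarrow> Br A R B \<in> M \<longleftrightarrow> Br C R D \<in> M"
  using model_Thm[OF Br_cong[of A C B D R], of M] model_Thm[OF Br_cong[of C A D B R], of M]
    model_eq_sym by auto

lemma Uni_cong: "Thm (A \<^bold>= B \<^bold>\<longrightarrow> Uni A \<^bold>= Uni B)"
proof -
  obtain x where x: "x \<notin> vars (cexpr A)" "x \<notin> vars (cexpr B)" by (rule fresh_for)
  obtain y where y: "y \<notin> vars (cexpr A)" "y \<notin> vars (cexpr B)" "y \<notin> vars (cexpr (SV x))"
    by (rule fresh_for)
  then have xy: "x \<noteq> y" by simp
  have "Thm (A \<^bold>= B \<^bold>\<longrightarrow> (SV x \<^bold>\<in> SV y \<^bold>\<and> SV y \<^bold>\<in> A) \<^bold>\<longleftrightarrow> (SV x \<^bold>\<in> SV y \<^bold>\<and> SV y \<^bold>\<in> B))"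
    by (rule Thm_if_models) (auto simp: model_mem_eq)
  then have "Thm (A \<^bold>= B \<^bold>\<longrightarrow> Ex y (SV x \<^bold>\<in> SV y \<^bold>\<and> SV y \<^bold>\<in> A) \<^bold>\<longleftrightarrow> Ex y (SV x \<^bold>\<in> SV y \<^bold>\<and> SV y \<^bold>\<in> B))"
    by (rule Thm_ex_cong) (use y in simp)
  then have "Thm (A \<^bold>= B \<^bold>\<longrightarrow> Ab x (Ex y (SV x \<^bold>\<in> SV y \<^bold>\<and> SV y \<^bold>\<in> A)) \<^bold>= Ab x (Ex y (SV x \<^bold>\<in> SV y \<^bold>\<and> SV y \<^bold>\<in> B)))"
    by (rule Ab_cong) (use x in simp)
  from model_Thm[OF this] show ?thesis
    by (intro Thm_if_models)
      (use model_eq_cong[OF _ model_Thm[OF df_uni[OF x(1) y(1) xy]]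
        model_Thm[OF df_uni[OF x(2) y(2) xy]]] in auto)
qed

lemma Iota_cong:
  assumes "Thm (g \<^bold>\<longrightarrow> p \<^bold>\<longleftrightarrow> q)" "x \<notin> vars (wexpr g)"
  shows "Thm (g \<^bold>\<longrightarrow> Iota x p \<^bold>= Iota x q)"
proof -
  let ?S = "insert x (vars (wexpr g) \<union> vars (wexpr p) \<union> vars (wexpr q))"
  obtain y where "y \<notin> ?S" by (rule fresh_var[of ?S]) simp
  then have y: "x \<noteq> y" "y \<notin> vars (wexpr g)" "y \<notin> vars (wexpr p)" "y \<notin> vars (wexpr q)" by auto
  have "Thm (g \<^bold>\<longrightarrow> Ab x p \<^bold>= Sn (SV y) \<^bold>\<longleftrightarrow> Ab x q \<^bold>= Sn (SV y))"
    by (rule Thm_if_models)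
      (use model_Thm[OF Ab_cong[OF assms]]
        model_eq_cong[OF _ _ model_Thm[OF Thm_eq_refl[of "Sn (SV y)"]], of _ "Ab x p" "Ab x q"] in auto)
  then have "Thm (g \<^bold>\<longrightarrow> Ab y (Ab x p \<^bold>= Sn (SV y)) \<^bold>= Ab y (Ab x q \<^bold>= Sn (SV y)))"
    by (rule Ab_cong) (rule y)
  from model_Thm[OF this] show ?thesis
    by (intro Thm_if_models)
      (use model_eq_cong[OF _ model_Thm[OF df_iota[OF y(1,3)]] model_Thm[OF df_iota[OF y(1,4)]]]
        model_Thm[OF Uni_cong[of "Ab y (Ab x p \<^bold>= Sn (SV y))" "Ab y (Ab x q \<^bold>= Sn (SV y))"]] in auto)
qed

lemma Fv_cong: "Thm (A \<^bold>= B \<^bold>\<longrightarrow> Fv F A \<^bold>= Fv F B)"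
proof -
  obtain x where x: "x \<notin> vars (cexpr A)" "x \<notin> vars (cexpr B)" "x \<notin> vars (cexpr F)"
    by (rule fresh_for)
  have "Thm (A \<^bold>= B \<^bold>\<longrightarrow> Br A F (SV x) \<^bold>\<longleftrightarrow> Br B F (SV x))"
    by (rule Thm_if_models) (simp add: model_Br_cong model_Thm[OF Thm_eq_refl])
  then have "Thm (A \<^bold>= B \<^bold>\<longrightarrow> Iota x (Br A F (SV x)) \<^bold>= Iota x (Br B F (SV x)))"
    by (rule Iota_cong) (use x in simp)
  from model_Thm[OF this] show ?thesis
    by (intro Thm_if_models)
      (use model_eq_cong[OF _ model_Thm[OF df_fv[OF x(1,3)]] model_Thm[OF df_fv[OF x(2,3)]]] in auto)
qed

text \<open>This is what makes an operation on equality classes well defined.\<close>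

lemma model_Ov_cong:
  assumes M: "model M" and "(A \<^bold>= C) \<in> M" "(B \<^bold>= D) \<in> M"
  shows "(Ov A F B \<^bold>= Ov C F D) \<in> M"
  using model_Thm[OF Op_cong[of A C B D] M] model_Thm[OF Fv_cong[of "Op A B" "Op C D" F] M]
    model_eq_cong[OF M model_Thm[OF df_ov[of A F B] M] model_Thm[OF df_ov[of C F D] M]] assms
  by simp

text \<open>A member \<open>A\<close> of a class equals some set variable, so it suffices to reason
  about a variable \<open>x\<close> equal to \<open>A\<close>.\<close>

lemma exE_clel:
  assumes "Thm (SV x \<^bold>= A \<^bold>\<longrightarrow> SV x \<^bold>\<in> B \<^bold>\<longrightarrow> q)"
    and "x \<notin> vars (cexpr A)" "x \<notin> vars (cexpr B)" "x \<notin> vars (wexpr q)"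
  shows "Thm (A \<^bold>\<in> B \<^bold>\<longrightarrow> q)"
proof -
  have "Thm ((SV x \<^bold>= A \<^bold>\<and> SV x \<^bold>\<in> B) \<^bold>\<longrightarrow> q)"
    by (rule Thm_if_models) (use model_Thm[OF assms(1)] in auto)
  then have "Thm (Ex x (SV x \<^bold>= A \<^bold>\<and> SV x \<^bold>\<in> B) \<^bold>\<longrightarrow> q)" by (rule Thm_exE) (rule assms(4))
  from model_Thm[OF this] show ?thesis
    by (intro Thm_if_models) (use model_Thm[OF df_clel[OF assms(2,3)]] in auto)
qed

text \<open>The rule by which the existential axioms are used: the premise treats \<open>x\<close>
  as a witness, and \<open>q\<close> has forgotten it.\<close>

lemma rexE:
  assumes "Thm (SV x \<^bold>\<in> A \<^bold>\<longrightarrow> p \<^bold>\<longrightarrow> q)" "x \<notin> vars (wexpr q)"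
  shows "Thm (Rex x A p \<^bold>\<longrightarrow> q)"
proof -
  have "Thm ((SV x \<^bold>\<in> A \<^bold>\<and> p) \<^bold>\<longrightarrow> q)"
    by (rule Thm_if_models) (use model_Thm[OF assms(1)] in auto)
  from model_Thm[OF Thm_exE[OF this assms(2)]] show ?thesis
    by (intro Thm_if_models) (auto simp: model_Rex)
qed

text \<open>\<open>abid\<close> speaks of set variables only, so membership in
  \<open>Cap RR CC\<close> is unfolded for a variable equal to \<open>A\<close>.\<close>

lemma real_complex: "Thm (A \<^bold>\<in> RR \<^bold>\<longrightarrow> A \<^bold>\<in> CC)"
proof -
  obtain x where x: "x \<notin> vars (cexpr A)" by (rule fresh_for)
  have "Thm (SV x \<^bold>= A \<^bold>\<longrightarrow> SV x \<^bold>\<in> RR \<^bold>\<longrightarrow> A \<^bold>\<in> CC)"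
  proof (rule Thm_if_models)
    fix M assume M: "model M"
    have RR: "(Cap RR CC \<^bold>= RR) \<in> M"
      using model_Thm[OF df_ss[of RR CC] M] model_Thm[OF resscn M] M by simp
    have "(Cap RR CC \<^bold>= Ab x (SV x \<^bold>\<in> RR \<^bold>\<and> SV x \<^bold>\<in> CC)) \<in> M"
      by (rule model_Thm[OF df_in M]) simp_all
    then have "(SV x \<^bold>\<in> RR) \<in> M \<longleftrightarrow> (SV x \<^bold>\<in> Ab x (SV x \<^bold>\<in> RR \<^bold>\<and> SV x \<^bold>\<in> CC)) \<in> M"
      using model_mem_eq[OF M RR] model_mem_eq[OF M] by blast
    then have "(SV x \<^bold>\<in> RR) \<in> M \<longrightarrow> (SV x \<^bold>\<in> CC) \<in> M"
      using model_Thm[OF abid[of x "SV x \<^bold>\<in> RR \<^bold>\<and> SV x \<^bold>\<in> CC"] M] M by auto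
    then show "(SV x \<^bold>= A \<^bold>\<longrightarrow> SV x \<^bold>\<in> RR \<^bold>\<longrightarrow> A \<^bold>\<in> CC) \<in> M"
      using model_mem_cong[OF M, of "SV x" A CC] M by simp
  qed
  then show ?thesis by (rule exE_clel) (use x in simp_all)
qed

text \<open>No axiom of pairing is needed: \<open>A <RR B\<close> means that the ordered pair belongs to a class,
  so the pair is a set.\<close>

lemma lt_if_rlt: "Thm (A \<^bold>\<in> RR \<^bold>\<longrightarrow> B \<^bold>\<in> RR \<^bold>\<longrightarrow> A \<^bold>< B \<^bold>\<longrightarrow> Br A (Con ''<'') B)"
proof -
  obtain x where x: "x \<notin> vars (cexpr A)" "x \<notin> vars (cexpr B)" by (rule fresh_for)
  obtain y where y: "y \<notin> vars (cexpr A)" "y \<notin> vars (cexpr B)" "y \<notin> vars (cexpr (SV x))"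
    by (rule fresh_for)
  obtain z where z: "z \<notin> vars (cexpr A)" "z \<notin> vars (cexpr B)" "z \<notin> vars (cexpr (SV x))"
    "z \<notin> vars (cexpr (SV y))" by (rule fresh_for)
  have xyz: "x \<noteq> y" "x \<noteq> z" "y \<noteq> z" using y z by auto
  let ?p = "And3 (SV x \<^bold>\<in> RR) (SV y \<^bold>\<in> RR) (SV x \<^bold>< SV y)"
  let ?q = "SV z \<^bold>= Op (SV x) (SV y) \<^bold>\<and> ?p"
  let ?O = "Opab x y ?p"
  let ?U = "Cup (Xp (Cup RR (Sn (Con ''-oo''))) (Sn (Con ''+oo''))) (Xp (Sn (Con ''-oo'')) RR)"
  \<comment> \<open>\<open>z\<close> stands for the ordered pair, \<open>x\<close> and
    \<open>y\<close> for its components. Each variable has an equation followed by a membership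
    among the antecedents, the shape that \<open>exE_clel\<close> eliminates.\<close>
  have "Thm (SV z \<^bold>= Op A B \<^bold>\<longrightarrow> SV z \<^bold>\<in> Con ''<RR'' \<^bold>\<longrightarrow> SV x \<^bold>= A \<^bold>\<longrightarrow> SV x \<^bold>\<in> RR \<^bold>\<longrightarrow>
      SV y \<^bold>= B \<^bold>\<longrightarrow> SV y \<^bold>\<in> RR \<^bold>\<longrightarrow> Br A (Con ''<'') B)" (is "Thm ?r")
  proof (rule Thm_if_models)
    fix M assume M: "model M"
    have O: "(?O \<^bold>= Ab z (Ex x (Ex y ?q))) \<in> M"
      by (rule model_Thm[OF df_opab M]) (use xyz in auto)
    have U: "(Cup ?O ?U \<^bold>= Ab z (SV z \<^bold>\<in> ?O \<^bold>\<or> SV z \<^bold>\<in> ?U)) \<in> M"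
      by (rule model_Thm[OF df_un M]) (use xyz in auto)
    have L: "(Con ''<'' \<^bold>= Cup ?O ?U) \<in> M"
      by (rule model_Thm[OF df_ltxr[OF xyz(1)] M])
    show "?r \<in> M"
    proof (simp only: model_Imp[OF M], intro impI)
      assume h: "(SV z \<^bold>= Op A B) \<in> M" "(SV z \<^bold>\<in> Con ''<RR'') \<in> M" "(SV x \<^bold>= A) \<in> M"
        "(SV x \<^bold>\<in> RR) \<in> M" "(SV y \<^bold>= B) \<in> M" "(SV y \<^bold>\<in> RR) \<in> M"
      have "(Op (SV x) (SV y) \<^bold>= Op A B) \<in> M"
        using model_Thm[OF Op_cong M, of "SV x" A "SV y" B] h M by simp
      then have zxy: "(SV z \<^bold>= Op (SV x) (SV y)) \<in> M"
        using h(1) model_eq_trans[OF M] model_eq_sym[OF M] by blast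
      have "(SV x \<^bold>< SV y) \<in> M"
        using model_mem_cong[OF M zxy h(2)] model_Thm[OF df_br M, of "SV x" "Con ''<RR''" "SV y"] M by simp
      then have "?q \<in> M" using zxy h M by simp
      \<comment> \<open>The variables bound in \<open>?O\<close> are their own witnesses.\<close>
      then have "Ex x (Ex y ?q) \<in> M"
        using model_Thm[OF Thm_exI M, of ?q y] model_Thm[OF Thm_exI M, of "Ex y ?q" x] M by simp
      then have "(SV z \<^bold>\<in> ?O) \<in> M"
        using model_Thm[OF abid M, of z "Ex x (Ex y ?q)"] model_mem_eq[OF M O] M by simp
      then have "(SV z \<^bold>\<in> Con ''<'') \<in> M"
        using model_Thm[OF abid M, of z "SV z \<^bold>\<in> ?O \<^bold>\<or> SV z \<^bold>\<in> ?U"] model_mem_eq[OF M U]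
          model_mem_eq[OF M L] M by simp
      then have "(Op A B \<^bold>\<in> Con ''<'') \<in> M" by (rule model_mem_cong[OF M h(1)])
      then show "Br A (Con ''<'') B \<in> M" using model_Thm[OF df_br M, of A "Con ''<''" B] M by simp
    qed
  qed
  then have "Thm (Op A B \<^bold>\<in> Con ''<RR'' \<^bold>\<longrightarrow> SV x \<^bold>= A \<^bold>\<longrightarrow> SV x \<^bold>\<in> RR \<^bold>\<longrightarrow>
      SV y \<^bold>= B \<^bold>\<longrightarrow> SV y \<^bold>\<in> RR \<^bold>\<longrightarrow> Br A (Con ''<'') B)"
    by (rule exE_clel) (use z xyz in simp_all)
  \<comment> \<open>The antecedents are permuted so that the next variable to be eliminated stands
    in front.\<close>
  from model_Thm[OF this] have "Thm (SV x \<^bold>= A \<^bold>\<longrightarrow> SV x \<^bold>\<in> RR \<^bold>\<longrightarrow>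
      Op A B \<^bold>\<in> Con ''<RR'' \<^bold>\<longrightarrow> SV y \<^bold>= B \<^bold>\<longrightarrow> SV y \<^bold>\<in> RR \<^bold>\<longrightarrow> Br A (Con ''<'') B)"
    by (intro Thm_if_models) auto
  then have "Thm (A \<^bold>\<in> RR \<^bold>\<longrightarrow> Op A B \<^bold>\<in> Con ''<RR'' \<^bold>\<longrightarrow> SV y \<^bold>= B \<^bold>\<longrightarrow> SV y \<^bold>\<in> RR \<^bold>\<longrightarrow> Br A (Con ''<'') B)"
    by (rule exE_clel) (use x xyz in simp_all)
  from model_Thm[OF this] have "Thm (SV y \<^bold>= B \<^bold>\<longrightarrow> SV y \<^bold>\<in> RR \<^bold>\<longrightarrow>
      A \<^bold>\<in> RR \<^bold>\<longrightarrow> Op A B \<^bold>\<in> Con ''<RR'' \<^bold>\<longrightarrow> Br A (Con ''<'') B)"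
    by (intro Thm_if_models) auto
  then have "Thm (B \<^bold>\<in> RR \<^bold>\<longrightarrow> A \<^bold>\<in> RR \<^bold>\<longrightarrow> Op A B \<^bold>\<in> Con ''<RR'' \<^bold>\<longrightarrow> Br A (Con ''<'') B)"
    by (rule exE_clel) (use y xyz in simp_all)
  from model_Thm[OF this] show ?thesis
    by (intro Thm_if_models) (use model_Thm[OF df_br[of A "Con ''<RR''" B]] in auto)
qed

section \<open>Arithmetic without commutativity of addition\<close>

text \<open>What a model satisfies without witnesses: \<open>K\<close> and \<open>R\<close> hold the
  complex and the real classes, \<open>u\<close> and \<open>z\<close> are one and zero. Neither of
  the two is assumed to lie in \<open>R\<close>, and no inverses are assumed.\<close>

locale pre_arith =
  fixes K R :: "'a set" and add mul :: "'a \<Rightarrow> 'a \<Rightarrow> 'a" and z u i :: 'a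
    and lt :: "'a \<Rightarrow> 'a \<Rightarrow> bool"
  assumes R_K: "R \<subseteq> K" and i_K: "i \<in> K" and u_K: "u \<in> K"
    and add_K: "\<lbrakk>a \<in> K; b \<in> K\<rbrakk> \<Longrightarrow> add a b \<in> K"
    and add_R: "\<lbrakk>a \<in> R; b \<in> R\<rbrakk> \<Longrightarrow> add a b \<in> R"
    and mul_K: "\<lbrakk>a \<in> K; b \<in> K\<rbrakk> \<Longrightarrow> mul a b \<in> K"
    and mul_R: "\<lbrakk>a \<in> R; b \<in> R\<rbrakk> \<Longrightarrow> mul a b \<in> R"
    and mul_commute: "\<lbrakk>a \<in> K; b \<in> K\<rbrakk> \<Longrightarrow> mul a b = mul b a"
    and add_assoc: "\<lbrakk>a \<in> K; b \<in> K; c \<in> K\<rbrakk> \<Longrightarrow> add (add a b) c = add a (add b c)"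
    and distrib: "\<lbrakk>a \<in> K; b \<in> K; c \<in> K\<rbrakk> \<Longrightarrow> mul a (add b c) = add (mul a b) (mul a c)"
    and i_square: "add (mul i i) u = z"
    and u_neq_z: "u \<noteq> z"
    and mul_u: "a \<in> R \<Longrightarrow> mul a u = a"
    and lt_iff: "\<lbrakk>a \<in> R; b \<in> R\<rbrakk> \<Longrightarrow> lt a b \<longleftrightarrow> \<not> (a = b \<or> lt b a)"
    and lt_trans: "\<lbrakk>a \<in> R; b \<in> R; c \<in> R; lt a b; lt b c\<rbrakk> \<Longrightarrow> lt a c"
    and lt_add: "\<lbrakk>a \<in> R; b \<in> R; c \<in> R; lt a b\<rbrakk> \<Longrightarrow> lt (add c a) (add c b)"
    and mul_pos: "\<lbrakk>a \<in> R; b \<in> R; lt z a; lt z b\<rbrakk> \<Longrightarrow> lt z (mul a b)"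
begin

lemma K_if_R: "a \<in> R \<Longrightarrow> a \<in> K"
  using R_K by blast

lemma add_assoc_R: "\<lbrakk>a \<in> R; b \<in> R; c \<in> R\<rbrakk> \<Longrightarrow> add (add a b) c = add a (add b c)"
  by (simp add: K_if_R add_assoc)

lemma z_K: "z \<in> K"
  using add_K mul_K i_K u_K i_square by metis

text \<open>If \<open>a\<close> and \<open>b\<close> differ, trichotomy puts them in order, and
  \<open>lt_add\<close> would put the equal sums in order too.\<close>

lemma add_left_cancel: "\<lbrakk>a \<in> R; b \<in> R; c \<in> R; add c a = add c b\<rbrakk> \<Longrightarrow> a = b"
  by (metis add_R lt_add lt_iff)

text \<open>Cancel \<open>e\<close> on the left of \<open>e + (e + a) = e + a\<close>.\<close>

lemma idem_left_neutral: "\<lbrakk>e \<in> R; add e e = e; a \<in> R\<rbrakk> \<Longrightarrow> add e a = a"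
  by (metis add_R add_assoc_R add_left_cancel)

text \<open>Since \<open>u = y e\<close>, distributivity gives
  \<open>u = y (e + e) = u + u\<close>.\<close>

lemma u_idem_if_unit_idem:
  "\<lbrakk>e \<in> R; y \<in> R; add e e = e; mul e y = u\<rbrakk> \<Longrightarrow> add u u = u"
  by (metis K_if_R distrib mul_commute)

text \<open>\<open>a = a u = a (u + u) = a + a\<close>.\<close>

lemma idem_if_o_idem: "\<lbrakk>u \<in> R; add u u = u; a \<in> R\<rbrakk> \<Longrightarrow> add a a = a"
  by (metis K_if_R distrib mul_u)

text \<open>Cancel \<open>z\<close> in \<open>z + (c + c) = (z + c) + c = z + c\<close>.\<close>

lemma idem_if_add_z: "\<lbrakk>z \<in> R; c \<in> R; add z c = z\<rbrakk> \<Longrightarrow> add c c = c"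
  by (metis add_R add_assoc_R add_left_cancel)

text \<open>\<open>c\<close> is the witness for the negative of \<open>z\<close>. It is idempotent
  by the previous lemma, so it is \<open>z\<close> or makes \<open>u\<close> idempotent, and in the
  second case every real is idempotent.\<close>

lemma z_idem:
  assumes "z \<in> R" "u \<in> R" "c \<in> R" "add z c = z" "c = z \<or> add u u = u"
  shows "add z z = z"
  using assms idem_if_o_idem by metis

text \<open>The square of \<open>i\<close> is not known to be real, so associativity is used in
  \<open>K\<close>, and left neutrality only for \<open>z + u\<close>.\<close>

lemma u_not_idem:
  assumes "z \<in> R" "u \<in> R" "add z z = z"
  shows "add u u \<noteq> u"
proof
  assume "add u u = u"
  then have "z = add (add (mul i i) u) u"
    using add_assoc[of "mul i i" u u] mul_K i_K u_K i_square by simp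
  also have "\<dots> = u" using idem_left_neutral assms i_square by simp
  finally show False using u_neq_z by simp
qed

text \<open>\<open>x\<close> plays the part of \<open>-1\<close>. Uniqueness of the idempotent
  replaces commutativity: \<open>x + u\<close> and the products \<open>a z\<close> are recognized as
  zero because they are idempotent. The sign comes from \<open>x x = u\<close>: if
  \<open>1 < 0\<close> held, then \<open>0 < -1\<close>, and squaring would give
  \<open>0 < 1\<close>.\<close>

lemma z_neutral_and_pos:
  assumes z: "z \<in> R" "add z z = z" and u: "u \<in> R"
    and idem: "\<And>e. e \<in> R \<Longrightarrow> add e e = e \<Longrightarrow> e = z"
    and x: "x \<in> R" "add u x = z"
  shows "add u z = u \<and> lt z u"
proof -
  note left = idem_left_neutral[OF z]
  have xu: "add x u = z"
  proof (rule idem)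
    show "add x u \<in> R" by (rule add_R[OF x(1) u])
    \<comment> \<open>The inner sum \<open>u + x\<close> is zero, hence left neutral.\<close>
    have "add (add x u) (add x u) = add x (add (add u x) u)"
      by (simp add: add_R add_assoc_R u x(1))
    then show "add (add x u) (add x u) = add x u" using x(2) left u by simp
  qed
  have uz: "add u z = u"
    using add_assoc_R[OF u x(1) u] x(2) xu left[OF u] by simp
  have xz: "add x z = x"
    using add_assoc_R[OF x(1) u x(1)] x(2) xu left[OF x(1)] by simp
  have mz: "mul a z = z" if "a \<in> R" for a
    by (rule idem) (use that z distrib[of a z z] mul_R K_if_R in auto)
  \<comment> \<open>\<open>a + 0 = a 1 + a 0 = a (1 + 0) = a 1 = a\<close>.\<close>
  have right: "add a z = a" if "a \<in> R" for a
    using distrib[of a u z] uz mz[OF that] mul_u[OF that] K_if_R that u z by simp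
  \<comment> \<open>Expand \<open>x (x + u) = x 0 = 0\<close>; adding \<open>u\<close> on the right
    then isolates \<open>x x\<close>.\<close>
  have "add (mul x x) x = z"
    using distrib[of x x u] xu mz[OF x(1)] mul_u[OF x(1)] K_if_R x(1) u by simp
  then have "mul x x = u"
    using add_assoc_R[of "mul x x" x u] right[of "mul x x"] xu left[OF u] mul_R x(1) u by simp
  then have "lt z x \<Longrightarrow> lt z u" using mul_pos[of x x] x(1) by simp
  moreover have "lt u z \<Longrightarrow> lt z x" using lt_add[of u z x] xu xz x(1) u z by simp
  ultimately have "lt z u" using lt_iff[of z u] u_neq_z u z by metis
  with uz show ?thesis by simp
qed

end

locale arith = pre_arith +
  assumes z_R: "z \<in> R" and u_R: "u \<in> R" and z_add_z: "add z z = z"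
    and u_add_z: "add u z = u" and z_lt_u: "lt z u"
begin

text \<open>Ones are added on the right, as in the definitions of \<open>2\<close>, \<open>3\<close>
  and \<open>4\<close>.\<close>

primrec un :: "nat \<Rightarrow> 'a" where
  "un 0 = z"
| "un (Suc n) = add (un n) u"

lemma un_R [simp]: "un n \<in> R"
  by (induction n) (simp_all add: z_R u_R add_R)

lemma un_1: "un (Suc 0) = u"
  by (simp add: idem_left_neutral z_R z_add_z u_R)

text \<open>Right neutrality of \<open>z\<close> is assumed for \<open>z\<close> and
  \<open>u\<close> only; associativity extends it to sums ending in \<open>u\<close>.\<close>

lemma un_add_z: "add (un n) z = un n"
  by (cases n) (simp_all add: z_add_z add_assoc_R z_R u_R u_add_z)

lemma un_add: "un (m + n) = add (un m) (un n)"
  by (induction n) (simp_all add: un_add_z add_assoc_R u_R)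

text \<open>The right factor is a successor so that the induction starts at \<open>m * 1\<close>,
  which is the law \<open>mul_u\<close>, and proceeds by distributivity. In a numeral
  \<open>4 * n\<close> this uses the nonzero value of \<open>n\<close>.\<close>

lemma un_mult: "un (m * Suc n) = mul (un m) (un (Suc n))"
proof (induction n)
  case 0
  then show ?case using mul_u[of "un m"] un_1 by simp
next
  case (Suc n)
  have "un (m * Suc (Suc n)) = add (un (m * Suc n)) (un m)"
    using un_add[of "m * Suc n" m] by (simp add: algebra_simps)
  also have "\<dots> = add (mul (un m) (un (Suc n))) (mul (un m) u)"
    using Suc mul_u by simp
  also have "\<dots> = mul (un m) (add (un (Suc n)) u)"
    by (rule distrib[symmetric]) (use K_if_R un_R u_R in blast)+
  finally show ?case by simp
qed

text \<open>The step translates \<open>z < u\<close> by \<open>un n\<close> on the left, the side on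
  which \<open>lt_add\<close> acts.\<close>

lemma un_mono: "m < n \<Longrightarrow> lt (un m) (un n)"
proof (induction n)
  case (Suc n)
  have "lt (add (un n) z) (add (un n) u)"
    by (rule lt_add) (simp_all add: z_R u_R z_lt_u)
  then have "lt (un n) (un (Suc n))" by (simp add: un_add_z)
  with Suc show ?case using lt_trans[of "un m" "un n" "un (Suc n)"] un_R less_Suc_eq by metis
qed simp

end

section \<open>Class terms modulo equality in a model\<close>

definition val :: "wf set \<Rightarrow> cl \<Rightarrow> cl set" where
  "val M A = {B. (A \<^bold>= B) \<in> M}"

definition qset :: "wf set \<Rightarrow> cl \<Rightarrow> cl set set" where
  "qset M S = {val M A | A. (A \<^bold>\<in> S) \<in> M}"

text \<open>Defined by all representatives at once instead of a chosen one; congruence makes the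
  result a single equality class.\<close>

definition qop :: "wf set \<Rightarrow> cl \<Rightarrow> cl set \<Rightarrow> cl set \<Rightarrow> cl set" where
  "qop M F a b = {C. \<exists>A\<in>a. \<exists>B\<in>b. (Ov A F B \<^bold>= C) \<in> M}"

definition qrel :: "wf set \<Rightarrow> cl \<Rightarrow> cl set \<Rightarrow> cl set \<Rightarrow> bool" where
  "qrel M R a b \<longleftrightarrow> (\<exists>A\<in>a. \<exists>B\<in>b. Br A R B \<in> M)"

lemma model_refl: "model M \<Longrightarrow> (A \<^bold>= A) \<in> M"
  by (rule model_Thm[OF Thm_eq_refl])

text \<open>As a simplification rule this translates equations between values into equations in
  \<open>M\<close>.\<close>

lemma val_eq [simp]:
  assumes M: "model M"
  shows "val M A = val M B \<longleftrightarrow> (A \<^bold>= B) \<in> M"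
proof
  assume "val M A = val M B"
  moreover have "B \<in> val M B" using model_refl[OF M] by (simp add: val_def)
  ultimately show "(A \<^bold>= B) \<in> M" by (simp add: val_def set_eq_iff)
next
  assume AB: "(A \<^bold>= B) \<in> M"
  have "(A \<^bold>= C) \<in> M \<longleftrightarrow> (B \<^bold>= C) \<in> M" for C
    using model_eq_cong[OF M AB model_refl[OF M]] .
  then show "val M A = val M B" by (simp add: val_def)
qed

lemma qset_val [simp]:
  assumes M: "model M"
  shows "val M A \<in> qset M S \<longleftrightarrow> (A \<^bold>\<in> S) \<in> M"
proof
  assume "val M A \<in> qset M S"
  then obtain B where "val M A = val M B" "(B \<^bold>\<in> S) \<in> M" unfolding qset_def by blast
  then show "(A \<^bold>\<in> S) \<in> M" using model_mem_cong[OF M model_eq_sym[OF M]] M by simp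
qed (auto simp: qset_def)

lemma qsetE:
  assumes "a \<in> qset M S"
  obtains A where "a = val M A" "(A \<^bold>\<in> S) \<in> M"
  using assms unfolding qset_def by blast

lemma qop_val [simp]:
  assumes M: "model M"
  shows "qop M F (val M A) (val M B) = val M (Ov A F B)"
proof (intro set_eqI iffI)
  fix C assume "C \<in> qop M F (val M A) (val M B)"
  then obtain A' B' where "(A \<^bold>= A') \<in> M" "(B \<^bold>= B') \<in> M" and C: "(Ov A' F B' \<^bold>= C) \<in> M"
    unfolding qop_def val_def by blast
  then have "(Ov A F B \<^bold>= Ov A' F B') \<in> M" using model_Ov_cong[OF M] by blast
  from model_eq_trans[OF M this C] show "C \<in> val M (Ov A F B)" by (simp add: val_def)
next
  fix C assume "C \<in> val M (Ov A F B)"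
  then show "C \<in> qop M F (val M A) (val M B)"
    unfolding qop_def val_def using model_refl[OF M] by blast
qed

lemma qrel_val [simp]:
  assumes M: "model M"
  shows "qrel M R (val M A) (val M B) \<longleftrightarrow> Br A R B \<in> M"
proof
  assume "qrel M R (val M A) (val M B)"
  then obtain A' B' where "(A \<^bold>= A') \<in> M" "(B \<^bold>= B') \<in> M" "Br A' R B' \<in> M"
    unfolding qrel_def val_def by blast
  then show "Br A R B \<in> M" using model_Br_cong[OF M] by blast
next
  assume "Br A R B \<in> M"
  then show "qrel M R (val M A) (val M B)"
    unfolding qrel_def val_def using model_refl[OF M] by blast
qed

abbreviation "qadd M \<equiv> qop M (Con ''+'')"
abbreviation "qmul M \<equiv> qop M (Con ''x.'')"
abbreviation "qlt M \<equiv> qrel M (Con ''<RR'')"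

text \<open>Each law is an axiom scheme, or \<open>real_complex\<close>, read at representing
  terms.\<close>

lemma pre_arith_model:
  assumes M: "model M"
  shows "pre_arith (qset M CC) (qset M RR) (qadd M) (qmul M) (val M zero) (val M one) (val M im) (qlt M)"
proof
  show "qset M RR \<subseteq> qset M CC"
    using model_Thm[OF real_complex M] M by (auto elim!: qsetE)
  show "val M im \<in> qset M CC" "val M one \<in> qset M CC"
    using model_Thm[OF i_cn M] model_Thm[OF one_cn M] M by simp_all
  show "qadd M (qmul M (val M im) (val M im)) (val M one) = val M zero"
    using model_Thm[OF i2m1 M] M by simp
  show "val M one \<noteq> val M zero"
    using model_Thm[OF one_ne_zero M] M by simp
next
  fix a b assume "a \<in> qset M CC" "b \<in> qset M CC"
  then obtain A B where "a = val M A" "(A \<^bold>\<in> CC) \<in> M" "b = val M B" "(B \<^bold>\<in> CC) \<in> M"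
    by (metis qsetE)
  then show "qadd M a b \<in> qset M CC" "qmul M a b \<in> qset M CC" "qmul M a b = qmul M b a"
    using model_Thm[OF addcl[of A B] M] model_Thm[OF mulcl[of A B] M]
      model_Thm[OF mulcom[of A B] M] M by simp_all
next
  fix a b assume "a \<in> qset M RR" "b \<in> qset M RR"
  then obtain A B where "a = val M A" "(A \<^bold>\<in> RR) \<in> M" "b = val M B" "(B \<^bold>\<in> RR) \<in> M"
    by (metis qsetE)
  then show "qadd M a b \<in> qset M RR" "qmul M a b \<in> qset M RR"
    "qlt M a b \<longleftrightarrow> \<not> (a = b \<or> qlt M b a)"
    "qlt M (val M zero) a \<Longrightarrow> qlt M (val M zero) b \<Longrightarrow> qlt M (val M zero) (qmul M a b)"
    using model_Thm[OF addrcl[of A B] M] model_Thm[OF mulrcl[of A B] M]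
      model_Thm[OF lttri[of A B] M] model_Thm[OF mulgt0[of A B] M] M by simp_all
next
  fix a b c assume "a \<in> qset M CC" "b \<in> qset M CC" "c \<in> qset M CC"
  then obtain A B C where "a = val M A" "(A \<^bold>\<in> CC) \<in> M" "b = val M B" "(B \<^bold>\<in> CC) \<in> M"
    "c = val M C" "(C \<^bold>\<in> CC) \<in> M"
    by (metis qsetE)
  then show "qadd M (qadd M a b) c = qadd M a (qadd M b c)"
    "qmul M a (qadd M b c) = qadd M (qmul M a b) (qmul M a c)"
    using model_Thm[OF addass[of A B C] M] model_Thm[OF distr[of A B C] M] M by simp_all
next
  fix a b c assume "a \<in> qset M RR" "b \<in> qset M RR" "c \<in> qset M RR"
  then obtain A B C where "a = val M A" "(A \<^bold>\<in> RR) \<in> M" "b = val M B" "(B \<^bold>\<in> RR) \<in> M"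
    "c = val M C" "(C \<^bold>\<in> RR) \<in> M"
    by (metis qsetE)
  then show "qlt M a b \<Longrightarrow> qlt M b c \<Longrightarrow> qlt M a c"
    "qlt M a b \<Longrightarrow> qlt M (qadd M c a) (qadd M c b)"
    using model_Thm[OF lttrn[of A B C] M] model_Thm[OF ltadd[of A B C] M] M by simp_all
next
  fix a assume "a \<in> qset M RR"
  then obtain A where "a = val M A" "(A \<^bold>\<in> RR) \<in> M" by (metis qsetE)
  then show "qmul M a (val M one) = a"
    using model_Thm[OF mul_one[of A] M] M by simp
qed

section \<open>Zero and one: membership in the reals, neutrality, order\<close>

lemma rrecexE:
  assumes "Thm (SV x \<^bold>\<in> RR \<^bold>\<longrightarrow> A \<^bold>* SV x \<^bold>= one \<^bold>\<longrightarrow> q)"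
    and "x \<notin> vars (cexpr A)" "x \<notin> vars (wexpr q)"
  shows "Thm (A \<^bold>\<in> RR \<^bold>\<longrightarrow> Ne A zero \<^bold>\<longrightarrow> q)"
  by (rule Thm_if_models)
    (use model_Thm[OF rexE[OF assms(1,3)]] model_Thm[OF rrecex[OF assms(2)]] in auto)

text \<open>The product of \<open>A\<close> with its reciprocal is real and equals
  \<open>1\<close>.\<close>

lemma one_real_if_nonzero: "Thm (A \<^bold>\<in> RR \<^bold>\<longrightarrow> Ne A zero \<^bold>\<longrightarrow> one \<^bold>\<in> RR)"
proof -
  obtain x where x: "x \<notin> vars (cexpr A)" by (rule fresh_for)
  have "Thm (SV x \<^bold>\<in> RR \<^bold>\<longrightarrow> A \<^bold>* SV x \<^bold>= one \<^bold>\<longrightarrow> (A \<^bold>\<in> RR \<^bold>\<longrightarrow> one \<^bold>\<in> RR))"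
  proof (rule Thm_if_models)
    fix M assume M: "model M"
    show "(SV x \<^bold>\<in> RR \<^bold>\<longrightarrow> A \<^bold>* SV x \<^bold>= one \<^bold>\<longrightarrow> (A \<^bold>\<in> RR \<^bold>\<longrightarrow> one \<^bold>\<in> RR)) \<in> M"
      using model_Thm[OF mulrcl[of A "SV x"] M] model_mem_cong[OF M, of "A \<^bold>* SV x" one RR] M by simp
  qed
  then have "Thm (A \<^bold>\<in> RR \<^bold>\<longrightarrow> Ne A zero \<^bold>\<longrightarrow> (A \<^bold>\<in> RR \<^bold>\<longrightarrow> one \<^bold>\<in> RR))"
    by (rule rrecexE) (use x in simp_all)
  from model_Thm[OF this] show ?thesis by (intro Thm_if_models) auto
qed

text \<open>Of the real and imaginary parts of \<open>1\<close> and \<open>0\<close> one is nonzero, since otherwise \<open>1\<close> and \<open>0\<close>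
  would both equal \<open>0 + i 0\<close>; a nonzero real times its reciprocal is \<open>1\<close>.\<close>

lemma one_real: "Thm (one \<^bold>\<in> RR)"
proof -
  let ?a = "SV ''a''" and ?b = "SV ''b''" and ?c = "SV ''c''" and ?d = "SV ''d''"
  let ?e = "\<lambda>A a b. A \<^bold>= a \<^bold>+ im \<^bold>* b"
  let ?g = "one \<^bold>\<in> RR"
  \<comment> \<open>The antecedents follow the order of elimination: \<open>d\<close> before
    \<open>c\<close> and \<open>b\<close> before \<open>a\<close>, since in each pair the first is
    bound inside the scope of the second.\<close>
  have "Thm (?d \<^bold>\<in> RR \<^bold>\<longrightarrow> ?e zero ?c ?d \<^bold>\<longrightarrow> ?c \<^bold>\<in> RR \<^bold>\<longrightarrow> ?b \<^bold>\<in> RR \<^bold>\<longrightarrow> ?e one ?a ?b \<^bold>\<longrightarrow> ?a \<^bold>\<in> RR \<^bold>\<longrightarrow> ?g)"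
    (is "Thm ?h")
  proof (rule Thm_if_models)
    fix M assume M: "model M"
    interpret pre_arith "qset M CC" "qset M RR" "qadd M" "qmul M" "val M zero" "val M one"
      "val M im" "qlt M" by (rule pre_arith_model[OF M])
    show "?h \<in> M"
    proof (simp only: model_Imp[OF M], intro impI, rule ccontr)
      assume h: "(?d \<^bold>\<in> RR) \<in> M" "?e zero ?c ?d \<in> M" "(?c \<^bold>\<in> RR) \<in> M" "(?b \<^bold>\<in> RR) \<in> M"
        "?e one ?a ?b \<in> M" "(?a \<^bold>\<in> RR) \<in> M" and n: "?g \<notin> M"
      \<comment> \<open>If \<open>1\<close> is not real, there is no nonzero real.\<close>
      have "val M A = val M zero" if "(A \<^bold>\<in> RR) \<in> M" for A
        using model_Thm[OF one_real_if_nonzero[of A] M] that n M by simp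
      then have v: "val M ?a = val M zero" "val M ?b = val M zero" "val M ?c = val M zero"
        "val M ?d = val M zero" using h by blast+
      have "val M one = qadd M (val M ?a) (qmul M (val M im) (val M ?b))"
        "val M zero = qadd M (val M ?c) (qmul M (val M im) (val M ?d))"
        using h M by (simp_all del: val_eq add: val_eq[OF M])
      then show False using u_neq_z unfolding v by simp
    qed
  qed
  then have "Thm (Rex ''d'' RR (?e zero ?c ?d) \<^bold>\<longrightarrow> ?c \<^bold>\<in> RR \<^bold>\<longrightarrow> ?b \<^bold>\<in> RR \<^bold>\<longrightarrow> ?e one ?a ?b \<^bold>\<longrightarrow> ?a \<^bold>\<in> RR \<^bold>\<longrightarrow> ?g)"
    by (rule rexE) simp
  from model_Thm[OF this]
  have "Thm (?c \<^bold>\<in> RR \<^bold>\<longrightarrow> Rex ''d'' RR (?e zero ?c ?d) \<^bold>\<longrightarrow> ?b \<^bold>\<in> RR \<^bold>\<longrightarrow> ?e one ?a ?b \<^bold>\<longrightarrow> ?a \<^bold>\<in> RR \<^bold>\<longrightarrow> ?g)"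
    by (intro Thm_if_models) auto
  then have "Thm (Rex ''c'' RR (Rex ''d'' RR (?e zero ?c ?d)) \<^bold>\<longrightarrow> ?b \<^bold>\<in> RR \<^bold>\<longrightarrow> ?e one ?a ?b \<^bold>\<longrightarrow> ?a \<^bold>\<in> RR \<^bold>\<longrightarrow> ?g)"
    by (rule rexE) simp
  from model_Thm[OF this]
  have "Thm (?b \<^bold>\<in> RR \<^bold>\<longrightarrow> ?e one ?a ?b \<^bold>\<longrightarrow> ?a \<^bold>\<in> RR \<^bold>\<longrightarrow>
      Rex ''c'' RR (Rex ''d'' RR (?e zero ?c ?d)) \<^bold>\<longrightarrow> ?g)"
    by (intro Thm_if_models) auto
  then have "Thm (Rex ''b'' RR (?e one ?a ?b) \<^bold>\<longrightarrow> ?a \<^bold>\<in> RR \<^bold>\<longrightarrow>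
      Rex ''c'' RR (Rex ''d'' RR (?e zero ?c ?d)) \<^bold>\<longrightarrow> ?g)"
    by (rule rexE) simp
  from model_Thm[OF this]
  have "Thm (?a \<^bold>\<in> RR \<^bold>\<longrightarrow> Rex ''b'' RR (?e one ?a ?b) \<^bold>\<longrightarrow>
      Rex ''c'' RR (Rex ''d'' RR (?e zero ?c ?d)) \<^bold>\<longrightarrow> ?g)"
    by (intro Thm_if_models) auto
  then have r: "Thm (Rex ''a'' RR (Rex ''b'' RR (?e one ?a ?b)) \<^bold>\<longrightarrow>
      Rex ''c'' RR (Rex ''d'' RR (?e zero ?c ?d)) \<^bold>\<longrightarrow> ?g)"
    by (rule rexE) simp
  show ?thesis
  proof (rule Thm_if_models)
    fix M assume M: "model M"
    interpret pre_arith "qset M CC" "qset M RR" "qadd M" "qmul M" "val M zero" "val M one"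
      "val M im" "qlt M" by (rule pre_arith_model[OF M])
    \<comment> \<open>No axiom states this; it holds because \<open>0\<close> is
      \<open>i i + 1\<close>.\<close>
    have "(zero \<^bold>\<in> CC) \<in> M" using z_K M by simp
    moreover have "(one \<^bold>\<in> CC) \<in> M" using u_K M by simp
    moreover have "Thm (one \<^bold>\<in> CC \<^bold>\<longrightarrow> Rex ''a'' RR (Rex ''b'' RR (?e one ?a ?b)))"
      "Thm (zero \<^bold>\<in> CC \<^bold>\<longrightarrow> Rex ''c'' RR (Rex ''d'' RR (?e zero ?c ?d)))"
      by (rule cnre; simp)+
    ultimately show "?g \<in> M"
      using model_Thm[OF r M] model_Thm[OF _ M] M by fastforce
  qed
qed

lemma rnegexE:
  assumes "Thm (SV x \<^bold>\<in> RR \<^bold>\<longrightarrow> A \<^bold>+ SV x \<^bold>= zero \<^bold>\<longrightarrow> q)"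
    and "x \<notin> vars (cexpr A)" "x \<notin> vars (wexpr q)"
  shows "Thm (A \<^bold>\<in> RR \<^bold>\<longrightarrow> q)"
  by (rule Thm_if_models)
    (use model_Thm[OF rexE[OF assms(1,3)]] model_Thm[OF rnegex[OF assms(2)]] in auto)

text \<open>\<open>0\<close> is the sum of \<open>1\<close> and its negative, both real.\<close>

lemma zero_real: "Thm (zero \<^bold>\<in> RR)"
proof -
  have "Thm (SV ''x'' \<^bold>\<in> RR \<^bold>\<longrightarrow> one \<^bold>+ SV ''x'' \<^bold>= zero \<^bold>\<longrightarrow> zero \<^bold>\<in> RR)"
  proof (rule Thm_if_models)
    fix M assume M: "model M"
    show "(SV ''x'' \<^bold>\<in> RR \<^bold>\<longrightarrow> one \<^bold>+ SV ''x'' \<^bold>= zero \<^bold>\<longrightarrow> zero \<^bold>\<in> RR) \<in> M"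
      using model_Thm[OF addrcl[of one "SV ''x''"] M] model_Thm[OF one_real M]
        model_mem_cong[OF M, of "one \<^bold>+ SV ''x''" zero RR] M by simp
  qed
  then have "Thm (one \<^bold>\<in> RR \<^bold>\<longrightarrow> zero \<^bold>\<in> RR)" by (rule rnegexE) simp_all
  then show ?thesis using one_real ax_mp by blast
qed

lemma one_idem_if_idem:
  "Thm (A \<^bold>\<in> RR \<^bold>\<longrightarrow> Ne A zero \<^bold>\<longrightarrow> A \<^bold>+ A \<^bold>= A \<^bold>\<longrightarrow> one \<^bold>+ one \<^bold>= one)"
proof -
  obtain x where x: "x \<notin> vars (cexpr A)" by (rule fresh_for)
  have "Thm (SV x \<^bold>\<in> RR \<^bold>\<longrightarrow> A \<^bold>* SV x \<^bold>= one \<^bold>\<longrightarrow> A \<^bold>\<in> RR \<^bold>\<longrightarrow> A \<^bold>+ A \<^bold>= A \<^bold>\<longrightarrow> one \<^bold>+ one \<^bold>= one)"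
    (is "Thm ?h")
  proof (rule Thm_if_models)
    fix M assume M: "model M"
    interpret pre_arith "qset M CC" "qset M RR" "qadd M" "qmul M" "val M zero" "val M one"
      "val M im" "qlt M" by (rule pre_arith_model[OF M])
    show "?h \<in> M" using u_idem_if_unit_idem[of "val M A" "val M (SV x)"] M by simp
  qed
  then have "Thm (A \<^bold>\<in> RR \<^bold>\<longrightarrow> Ne A zero \<^bold>\<longrightarrow> A \<^bold>\<in> RR \<^bold>\<longrightarrow> A \<^bold>+ A \<^bold>= A \<^bold>\<longrightarrow> one \<^bold>+ one \<^bold>= one)"
    by (rule rrecexE) (use x in simp_all)
  from model_Thm[OF this] show ?thesis by (intro Thm_if_models) auto
qed

text \<open>The witness \<open>x\<close> satisfies \<open>0 + x = 0\<close>, hence is idempotent,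
  and \<open>one_idem_if_idem\<close> yields the case distinction of \<open>z_idem\<close>.\<close>

lemma zero_plus_zero: "Thm (zero \<^bold>+ zero \<^bold>= zero)"
proof -
  have "Thm (SV ''x'' \<^bold>\<in> RR \<^bold>\<longrightarrow> zero \<^bold>+ SV ''x'' \<^bold>= zero \<^bold>\<longrightarrow> zero \<^bold>+ zero \<^bold>= zero)" (is "Thm ?h")
  proof (rule Thm_if_models)
    fix M assume M: "model M"
    interpret pre_arith "qset M CC" "qset M RR" "qadd M" "qmul M" "val M zero" "val M one"
      "val M im" "qlt M" by (rule pre_arith_model[OF M])
    show "?h \<in> M"
      using z_idem[of "val M (SV ''x'')"] idem_if_add_z[of "val M (SV ''x'')"]
        model_Thm[OF one_idem_if_idem[of "SV ''x''"] M] model_Thm[OF zero_real M]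
        model_Thm[OF one_real M] M by auto
  qed
  then have "Thm (zero \<^bold>\<in> RR \<^bold>\<longrightarrow> zero \<^bold>+ zero \<^bold>= zero)" by (rule rnegexE) simp_all
  then show ?thesis using zero_real ax_mp by blast
qed

text \<open>Both conclusions come from the same witness for the negative of \<open>1\<close>, which
  they do not mention; the conjunction lets one elimination serve both.\<close>

lemma one_plus_zero_and_pos: "Thm (one \<^bold>+ zero \<^bold>= one \<^bold>\<and> zero \<^bold>< one)"
proof -
  have "Thm (SV ''x'' \<^bold>\<in> RR \<^bold>\<longrightarrow> one \<^bold>+ SV ''x'' \<^bold>= zero \<^bold>\<longrightarrow> (one \<^bold>+ zero \<^bold>= one \<^bold>\<and> zero \<^bold>< one))"
    (is "Thm ?h")
  proof (rule Thm_if_models)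
    fix M assume M: "model M"
    interpret pre_arith "qset M CC" "qset M RR" "qadd M" "qmul M" "val M zero" "val M one"
      "val M im" "qlt M" by (rule pre_arith_model[OF M])
    have z: "val M zero \<in> qset M RR" "qadd M (val M zero) (val M zero) = val M zero"
      "val M one \<in> qset M RR"
      using model_Thm[OF zero_real M] model_Thm[OF zero_plus_zero M] model_Thm[OF one_real M] M
      by simp_all
    \<comment> \<open>Uniqueness of the idempotent is checked on a representing term, to which the
      theorem \<open>one_idem_if_idem\<close> applies.\<close>
    have "e = val M zero" if "e \<in> qset M RR" "qadd M e e = e" for e
    proof -
      obtain A where A: "e = val M A" "(A \<^bold>\<in> RR) \<in> M" using \<open>e \<in> qset M RR\<close> by (rule qsetE)
      then show ?thesis
        using model_Thm[OF one_idem_if_idem[of A] M] u_not_idem[OF z(1,3,2)] that M by auto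
    qed
    from z_neutral_and_pos[OF z this, of "val M (SV ''x'')"] show "?h \<in> M" using M by simp
  qed
  then have "Thm (one \<^bold>\<in> RR \<^bold>\<longrightarrow> (one \<^bold>+ zero \<^bold>= one \<^bold>\<and> zero \<^bold>< one))" by (rule rnegexE) simp_all
  then show ?thesis using one_real ax_mp by blast
qed

lemma arith_model:
  assumes M: "model M"
  shows "arith (qset M CC) (qset M RR) (qadd M) (qmul M) (val M zero) (val M one) (val M im) (qlt M)"
proof -
  interpret pre_arith "qset M CC" "qset M RR" "qadd M" "qmul M" "val M zero" "val M one"
    "val M im" "qlt M" by (rule pre_arith_model[OF M])
  show ?thesis
    by unfold_locales
      (use model_Thm[OF zero_real M] model_Thm[OF zero_plus_zero M] model_Thm[OF one_real M]
        model_Thm[OF one_plus_zero_and_pos M] M in auto)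
qed

section \<open>Numerals and their comparison\<close>

primrec tm :: "arith_term \<Rightarrow> cl" where
  "tm Zero = zero"
| "tm One = one"
| "tm Two = Con ''2''"
| "tm Three = Con ''3''"
| "tm Four = Con ''4''"
| "tm Five = Con ''5''"
| "tm Six = Con ''6''"
| "tm Seven = Con ''7''"
| "tm Eight = Con ''8''"
| "tm Nine = Con ''9''"
| "tm Ten = Con ''10''"
| "tm (Plus s t) = tm s \<^bold>+ tm t"
| "tm (Times s t) = tm s \<^bold>* tm t"

text \<open>The two syntaxes yield literally the same symbol sequence, which links
  \<open>Thm\<close> to \<open>less_wff\<close>.\<close>

lemma cexpr_tm [simp]: "cexpr (tm t) = term_expr t"
  by (induction t) (simp_all add: constants_def tokens_def)

lemma vars_term_expr [simp]: "vars (term_expr t) = {}"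
  by (induction t) simp_all

theorem theorem7:
  fixes \<Gamma> :: "frame set" and m n :: arith_term
  assumes "setmm_core \<subseteq> \<Gamma>"
    and "numeral_term m" and "numeral_term n"
    and "term_value m < term_value n"
  shows "\<Gamma> \<turnstile> less_wff m n"
proof -
  have "Thm (Br (tm m) (Con ''<'') (tm n))"
  proof (rule Thm_if_models)
    fix M assume M: "model M"
    interpret arith "qset M CC" "qset M RR" "qadd M" "qmul M" "val M zero" "val M one"
      "val M im" "qlt M" by (rule arith_model[OF M])
    have c: "val M (Con ''2'') = un 2" "val M (Con ''3'') = un 3" "val M (Con ''4'') = un 4"
    proof -
      have "val M (Con ''2'') = qadd M (val M one) (val M one)"
        using model_Thm[OF df_2 M] M by simp
      then show 2: "val M (Con ''2'') = un 2" using un_1 by (simp add: numeral_eq_Suc)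
      have "val M (Con ''3'') = qadd M (val M (Con ''2'')) (val M one)"
        using model_Thm[OF df_3 M] M by simp
      then show 3: "val M (Con ''3'') = un 3" unfolding 2 by (simp add: numeral_eq_Suc)
      have "val M (Con ''4'') = qadd M (val M (Con ''3'')) (val M one)"
        using model_Thm[OF df_4 M] M by simp
      then show "val M (Con ''4'') = un 4" unfolding 3 by (simp add: numeral_eq_Suc)
    qed
    have d: "val M (tm a) = un (term_value a)" if "a \<in> {Zero, One, Two, Three}" for a
      using that c un_1 by auto
    have v: "val M (tm t) = un (term_value t)" if "numeral_term t" for t
      using that
    proof induction
      case (digit a)
      then show ?case by (rule d)
    next
      case (step t a)
      \<comment> \<open>The nonzero value of the leading part supplies the successor that
        \<open>un_mult\<close> asks for.\<close>
      then obtain k where k: "term_value t = Suc k" using not0_implies_Suc by blast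
      have "val M (tm (Plus (Times Four t) a)) = qadd M (qmul M (un 4) (un (Suc k))) (un (term_value a))"
        using step k c(3) d[of a] M by (simp flip: qop_val del: un.simps)
      then show ?case using k by (simp add: un_add un_mult del: un.simps mult_Suc_right)
    qed
    have "(tm m \<^bold>\<in> RR) \<in> M" "(tm n \<^bold>\<in> RR) \<in> M"
      using un_R v[OF assms(2)] v[OF assms(3)] qset_val[OF M] by metis+
    moreover have "(tm m \<^bold>< tm n) \<in> M"
      using un_mono[OF assms(4)] v[OF assms(2)] v[OF assms(3)] qrel_val[OF M] by metis
    \<comment> \<open>The comparison so far is by \<open><RR\<close>; \<open>lt_if_rlt\<close>
      passes to \<open><\<close>.\<close>
    ultimately show "Br (tm m) (Con ''<'') (tm n) \<in> M"
      using model_Thm[OF lt_if_rlt M] M by simp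
  qed
  then have "Cn ''|-'' # less_wff m n \<in> Cl UNIV"
    by (simp add: Thm_def less_wff_def constants_def tokens_def)
  moreover have "vars (less_wff m n) = {}" by (simp add: less_wff_def)
  ultimately show ?thesis by (rule proves_if_Cl[OF _ _ assms(1)])
qed

end
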